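(* Let $\ell,T>0$, $N\in\mathbb{N}$, $P,Q\in(C^1[0,\ell])^{N\times N}$ and $\sigma\in\mathbb{C}\setminus\{0\}$. For $1\le k\le N$ let $u^k=(u^k_1,\dots,u^k_N)^T$ and $\widetilde{u}^k=(\widetilde{u}^k_1,\dots,\widetilde{u}^k_N)^T$ belong to $(C^{1,2}([0,T]\times[0,\ell]))^N$ and satisfy $$\sigma\partial_tu^k=\partial_x^2u^k-P(x)u^k,\qquad \sigma\partial_t\widetilde{u}^k=\partial_x^2\widetilde{u}^k-Q(x)\widetilde{u}^k,\qquad 0<x<\ell,\ 0<t<T.$$ Assume that one of the following two alternatives holds: (a) $u^k(0,x)=\widetilde{u}^k(0,x)$ for all $x\in(0,\ell)$ and all $k\in\{1,\dots,N\}$, and $|\det(u^1(0,x)\ \cdots\ u^N(0,x))|>0$ for all $x\in[0,\ell]$; (b) $u^k(T,x)=\widetilde{u}^k(T,x)$ for all $x\in(0,\ell)$ and all $k\in\{1,\dots,N\}$, and $|\det(u^1(T,x)\ \cdots\ u^N(T,x))|>0$ for all $x\in[0,\ell]$. Suppose additionally that there exists $\varepsilon_0\in(0,\ell)$ such that $P(x)=Q(x)$ for $x\in(0,\varepsilon_0)$. If $$u^k(t,0)=\widetilde{u}^k(t,0),\qquad \partial_xu^k(t,0)=\partial_x\widetilde{u}^k(t,0)\qquad\text{for all }t\in(0,T)\text{ and all }k\in\{1,\dots,N\},$$ then $P=Q$ on $[0,\ell]$.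
   Context: $C^{1,2}([0,T]\times[0,\ell])$ denotes the set of $u\in C([0,T]\times[0,\ell])$ such that $\partial_tu,\partial_xu,\partial_x^2u\in C([0,T]\times[0,\ell])$. $(u^1\ \cdots\ u^N)$ denotes the $N\times N$ matrix whose columns are the vectors $u^1,\dots,u^N$. Functions may be complex-valued. *)

theory Defs
  imports "HOL-Analysis.Analysis"
begin

text \<open>
  A function on \<open>[0,T] \<times> [0,\<ell>]\<close> is rendered as a total function of \<open>t\<close> and \<open>x\<close>, of which only the
  values on the rectangle matter. Derivatives are taken relative to the closed interval, so they
  are the ordinary ones in the interior and one-sided at the end points.
\<close>

definition C1_functions :: "real \<Rightarrow> (real \<Rightarrow> complex) set" where
  "C1_functions l = {f.
     (\<forall>x\<in>{0..l}. f differentiable (at x within {0..l})) \<and>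
     continuous_on {0..l} (\<lambda>x. vector_derivative f (at x within {0..l}))}"

definition partial_t :: "real \<Rightarrow> (real \<Rightarrow> real \<Rightarrow> 'a::real_normed_vector) \<Rightarrow> real \<Rightarrow> real \<Rightarrow> 'a" where
  "partial_t T u t x = vector_derivative (\<lambda>s. u s x) (at t within {0..T})"

definition partial_x :: "real \<Rightarrow> (real \<Rightarrow> real \<Rightarrow> 'a::real_normed_vector) \<Rightarrow> real \<Rightarrow> real \<Rightarrow> 'a" where
  "partial_x l u t x = vector_derivative (\<lambda>y. u t y) (at x within {0..l})"

definition partial_xx :: "real \<Rightarrow> (real \<Rightarrow> real \<Rightarrow> 'a::real_normed_vector) \<Rightarrow> real \<Rightarrow> real \<Rightarrow> 'a" where
  "partial_xx l u = partial_x l (partial_x l u)"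

text \<open>
  Differentiability is required explicitly, since \<^const>\<open>vector_derivative\<close> is an arbitrary
  value where no derivative exists.
\<close>

definition C12_functions :: "real \<Rightarrow> real \<Rightarrow> (real \<Rightarrow> real \<Rightarrow> complex) set" where
  "C12_functions T l = {u.
     (\<forall>t\<in>{0..T}. \<forall>x\<in>{0..l}.
        (\<lambda>s. u s x) differentiable (at t within {0..T}) \<and>
        (\<lambda>y. u t y) differentiable (at x within {0..l}) \<and>
        (\<lambda>y. partial_x l u t y) differentiable (at x within {0..l})) \<and>
     continuous_on ({0..T} \<times> {0..l}) (\<lambda>(t, x). u t x) \<and>
     continuous_on ({0..T} \<times> {0..l}) (\<lambda>(t, x). partial_t T u t x) \<and>
     continuous_on ({0..T} \<times> {0..l}) (\<lambda>(t, x). partial_x l u t x) \<and>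
     continuous_on ({0..T} \<times> {0..l}) (\<lambda>(t, x). partial_xx l u t x)}"

definition matrix_of_columns :: "('n \<Rightarrow> complex ^ 'n) \<Rightarrow> complex ^ 'n ^ 'n" where
  "matrix_of_columns v = (\<chi> i k. v k $ i)"

end

theory Submission
  imports Defs
begin

text \<open>
  Collect the \<open>u\<^sup>k\<close> into a matrix \<open>U\<close> and the \<open>u'\<^sup>k\<close> into \<open>V\<close>. Suppose \<open>P = Q\<close> on \<open>[0,c]\<close> with \<open>0 < c < l\<close>.
  Sideways uniqueness from the lateral Cauchy data gives \<open>V = U\<close> on \<open>[0,T] \<times> [0,c]\<close>. For small \<open>d\<close>, let \<open>K\<close>
  solve \<open>K\<^sub>x\<^sub>x - K\<^sub>y\<^sub>y = Q(x) K - K P(y)\<close> in the cone \<open>\<bar>y - c\<bar> \<le> x - c \<le> d\<close> with \<open>2 K(x,x)\<close> equal to the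
  integral of \<open>Q - P\<close> over \<open>[c,x]\<close>, and \<open>K = 0\<close> on the other edge. Then \<open>v(t,x) = \<integral> K(x,y) U(t,y) dy\<close>
  satisfies the same equation as \<open>V - U\<close>, so both agree on \<open>[c,c+d]\<close> by sideways uniqueness. The room
  \<open>d \<le> c\<close> to the left of \<open>c\<close> keeps the cone away from the boundary \<open>y = 0\<close>; this is where the knowledge of
  \<open>P = Q\<close> near \<open>0\<close> enters. At the time \<open>t\<^sub>0\<close> where \<open>U\<close> and \<open>V\<close> agree, \<open>v = 0\<close>; differentiating
  in \<open>x\<close> gives a homogeneous Volterra equation of the second kind for \<open>K(x,x)\<close>, because \<open>U(t\<^sub>0,x)\<close> is
  invertible. Hence \<open>P = Q\<close> on \<open>[c,c+d]\<close>, and a supremum argument finishes the proof.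

  Sideways uniqueness holds for every complex \<open>\<sigma>\<close>: testing the solution in time against
  \<open>(h\<^sup>2 - (t - t\<^sub>0)\<^sup>2)\<^sup>n\<close>, integrating by parts \<open>n\<close> times and solving the ODE in \<open>x\<close> each time yields a bound
  \<open>C D\<^sup>n / n!\<close>, whereas the Landau kernel would produce only exponential decay if the solution did not
  vanish at \<open>t\<^sub>0\<close>.
\<close>

subsection \<open>Integrals with a variable limit\<close>

lemma integral_unit_interval_scale:
  fixes f :: "real \<Rightarrow> 'a::euclidean_space"
  assumes "a \<le> b" "continuous_on {a..b} f"
  shows "integral {a..b} f = (b - a) *\<^sub>R integral {0..1} (\<lambda>\<tau>. f (a + \<tau> * (b - a)))"
proof (cases "a = b")
  case False
  then have "a < b" using assms by simp
  have "(f has_integral integral {a..b} f) (cbox a b)"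
    using assms integrable_continuous_real[OF assms(2)] by (simp add: integrable_integral)
  from has_integral_affinity'[OF this, of "b - a" a] \<open>a < b\<close>
  have "((\<lambda>x. f ((b - a) * x + a)) has_integral integral {a..b} f /\<^sub>R (b - a)) {0..1}"
    by simp
  then have "integral {0..1} (\<lambda>\<tau>. f ((b - a) * \<tau> + a)) = integral {a..b} f /\<^sub>R (b - a)"
    by (rule integral_unique)
  moreover have "(\<lambda>\<tau>. f ((b - a) * \<tau> + a)) = (\<lambda>\<tau>. f (a + \<tau> * (b - a)))"
    by (simp add: algebra_simps)
  ultimately show ?thesis using \<open>a < b\<close> by simp
qed simp

text \<open>Substituting \<open>y = a + \<tau> * (e p - a)\<close> moves the variable limit into the
  integrand and leaves a parameter integral over the fixed interval from 0 to 1.\<close>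

lemma continuous_on_integral_upper:
  fixes f :: "'p::topological_space \<Rightarrow> real \<Rightarrow> 'a::euclidean_space"
  assumes f: "continuous_on {(p, y). p \<in> S \<and> a \<le> y \<and> y \<le> e p} (\<lambda>(p, y). f p y)"
    and e: "continuous_on S e" and ae: "\<And>p. p \<in> S \<Longrightarrow> a \<le> e p"
  shows "continuous_on S (\<lambda>p. integral {a..e p} (f p))"
proof -
  have "continuous_on (S \<times> cbox 0 1) (\<lambda>(p, \<tau>). f p (a + \<tau> * (e p - a)))"
  proof -
    have e1: "continuous_on (S \<times> cbox 0 1) (\<lambda>x. e (fst x))"
      by (rule continuous_on_compose2[OF e]) (auto intro!: continuous_intros)
    have m: "\<tau> * (e p - a) \<le> e p - a" if "\<tau> \<le> 1" "p \<in> S" for p \<tau>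
      using that ae[of p] mult_right_mono[of \<tau> 1 "e p - a"] by simp
    have "continuous_on (S \<times> cbox 0 1) (\<lambda>x. (fst x, a + snd x * (e (fst x) - a)))"
      by (intro continuous_intros e1)
    from continuous_on_compose2[OF f this]
    show ?thesis using m ae by (fastforce simp: case_prod_beta)
  qed
  then have "continuous_on S (\<lambda>p. (e p - a) *\<^sub>R integral (cbox 0 1) (\<lambda>\<tau>. f p (a + \<tau> * (e p - a))))"
    by (intro continuous_intros e integral_continuous_on_param)
  moreover have "(e p - a) *\<^sub>R integral (cbox 0 1) (\<lambda>\<tau>. f p (a + \<tau> * (e p - a))) = integral {a..e p} (f p)"
    if "p \<in> S" for p
  proof -
    have "continuous_on {a..e p} (f p)"
      by (rule continuous_on_compose2[OF f, where f = "\<lambda>y. (p, y)", simplified])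
        (use that in \<open>auto intro!: continuous_intros\<close>)
    from integral_unit_interval_scale[OF ae[OF that] this] show ?thesis by simp
  qed
  ultimately show ?thesis using continuous_on_cong by fastforce
qed

text \<open>Leibniz rule for an integrand given only on the triangle \<open>y \<le> x\<close>.
  Continuing \<open>G\<close> across the diagonal along its tangent line in \<open>x\<close> keeps
  it continuously differentiable in \<open>x\<close> on the full square. There the variable in the
  integrand and the one in the limit can be varied separately and are joined again by the chain
  rule.\<close>

lemma has_vector_derivative_integral_triangle:
  fixes G :: "real \<Rightarrow> real \<Rightarrow> 'a::euclidean_space"
  assumes G: "continuous_on {(x, y). a \<le> y \<and> y \<le> x \<and> x \<le> b} (\<lambda>(x, y). G x y)"
    and G': "continuous_on {(x, y). a \<le> y \<and> y \<le> x \<and> x \<le> b} (\<lambda>(x, y). G' x y)"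
    and deriv: "\<And>x y. a \<le> y \<Longrightarrow> y \<le> x \<Longrightarrow> x \<le> b \<Longrightarrow>
        ((\<lambda>\<xi>. G \<xi> y) has_vector_derivative G' x y) (at x within {y..b})"
    and x: "x \<in> {a..b}"
  shows "((\<lambda>x. integral {a..x} (G x)) has_vector_derivative G x x + integral {a..x} (G' x))
           (at x within {a..b})"
proof -
  define H where "H x y = (if x \<in> {y..b} then G x y else G y y + (x - y) *\<^sub>R G' y y)" for x y
  define H' where "H' x y = (if x \<in> {y..b} then G' x y else G' y y)" for x y
  have H'_cont: "continuous_on ({a..b} \<times> {a..b}) (\<lambda>(x, y). H' x y)"
  proof -
    \<comment> \<open>For \<open>x < y\<close> the function \<open>H'\<close> is constant in
      \<open>x\<close>, so replacing \<open>x\<close> by \<open>max x y\<close> covers both cases by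
      one continuous formula.\<close>
    have "continuous_on ({a..b} \<times> {a..b}) (\<lambda>z. G' (max (fst z) (snd z)) (snd z))"
      by (rule continuous_on_compose2[OF G', where f = "\<lambda>z. (max (fst z) (snd z), snd z)", simplified])
        (auto intro!: continuous_intros)
    then show ?thesis
      by (rule continuous_on_eq) (auto simp: H'_def max_def)
  qed
  have H_cont: "continuous_on ({a..b} \<times> {a..b}) (\<lambda>(x, y). H x y)"
  proof -
    have 1: "continuous_on ({a..b} \<times> {a..b}) (\<lambda>z. G (max (fst z) (snd z)) (snd z))"
      by (rule continuous_on_compose2[OF G, where f = "\<lambda>z. (max (fst z) (snd z), snd z)", simplified])
        (auto intro!: continuous_intros)
    have 2: "continuous_on ({a..b} \<times> {a..b}) (\<lambda>z. G' (snd z) (snd z))"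
      by (rule continuous_on_compose2[OF G', where f = "\<lambda>z. (snd z, snd z)", simplified])
        (auto intro!: continuous_intros)
    have "continuous_on ({a..b} \<times> {a..b})
        (\<lambda>z. G (max (fst z) (snd z)) (snd z) + (min (fst z) (snd z) - snd z) *\<^sub>R G' (snd z) (snd z))"
      by (intro continuous_intros 1 2)
    then show ?thesis
      by (rule continuous_on_eq) (auto simp: H_def max_def min_def)
  qed
  have H_deriv: "((\<lambda>\<xi>. H \<xi> y) has_vector_derivative H' x y) (at x within {a..b})"
    if "x \<in> {a..b}" "y \<in> {a..b}" for x y
    unfolding H_def H'_def
  proof (rule has_vector_derivative_If_within_closures[where T = "{a..y}"])
    show "((\<lambda>\<xi>. G y y + (\<xi> - y) *\<^sub>R G' y y) has_vector_derivative G' y y)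
        (at x within {a..y} \<union> closure {y..b} \<inter> closure {a..y})"
      by (auto intro!: derivative_eq_intros simp: has_vector_derivative_def)
    show "((\<lambda>\<xi>. G \<xi> y) has_vector_derivative G' x y)
        (at x within {y..b} \<union> closure {y..b} \<inter> closure {a..y})"
      if "x \<in> {y..b} \<union> closure {y..b} \<inter> closure {a..y}"
    proof -
      have "{y..b} \<union> closure {y..b} \<inter> closure {a..y} = {y..b}" by auto
      with that show ?thesis using deriv[of y x] \<open>y \<in> {a..b}\<close> by auto
    qed
  qed (use that in auto)
  have Hx_cont: "continuous_on {a..b} (H x)" if "x \<in> {a..b}" for x
    by (rule continuous_on_compose2[OF H_cont, where f = "\<lambda>y. (x, y)", simplified])
      (use that in \<open>auto intro!: continuous_intros\<close>)
  \<comment> \<open>The integrand variable and the upper limit are independent here; the diagonal is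
    inserted afterwards.\<close>
  have "((\<lambda>(x, y). integral {a..y} (H x)) has_derivative
      (\<lambda>(tx, ty). tx *\<^sub>R integral {a..x} (H' x) + blinfun_scaleR_left (H x x) ty))
      (at (x, x) within {a..b} \<times> {a..b})"
  proof (rule has_derivative_partialsI[where fx = "\<lambda>t. t *\<^sub>R integral {a..x} (H' x)"
        and fy = "\<lambda>x y. blinfun_scaleR_left (H x y)"])
    have "((\<lambda>z. integral (cbox a x) (H z)) has_vector_derivative integral (cbox a x) (H' x))
        (at x within {a..b})"
    proof (rule leibniz_rule_vector_derivative)
      show "H z integrable_on cbox a x" if "z \<in> {a..b}" for z
        using continuous_on_subset[OF Hx_cont[OF that], of "{a..x}"] x
        by (auto intro!: integrable_continuous_real)
      show "continuous_on ({a..b} \<times> cbox a x) (\<lambda>(x, t). H' x t)"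
        by (rule continuous_on_subset[OF H'_cont]) (use x in auto)
    qed (use x H_deriv in auto)
    then show "((\<lambda>z. integral {a..x} (H z)) has_derivative (\<lambda>t. t *\<^sub>R integral {a..x} (H' x)))
        (at x within {a..b})"
      by (simp add: has_vector_derivative_def)
    show "((\<lambda>y. integral {a..y} (H z)) has_derivative blinfun_apply (blinfun_scaleR_left (H z y)))
        (at y within {a..b})" if "z \<in> {a..b}" "y \<in> {a..b}" for z y
      using integral_has_vector_derivative[OF Hx_cont[OF that(1)] that(2)]
      by (simp add: has_vector_derivative_def)
    have "continuous_on ({a..b} \<times> {a..b}) (\<lambda>z. blinfun_scaleR_left (H (fst z) (snd z)))"
      using H_cont by (intro continuous_intros) (auto simp: case_prod_beta)
    then have "continuous (at (x, x) within {a..b} \<times> {a..b})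
        (\<lambda>z. blinfun_scaleR_left (H (fst z) (snd z)))"
      using x by (simp add: continuous_on_eq_continuous_within)
    then show "continuous (at (x, x) within {a..b} \<times> {a..b}) (\<lambda>(x, y). blinfun_scaleR_left (H x y))"
      by (simp add: case_prod_unfold)
  qed (use x in auto)
  then have D: "((\<lambda>z. integral {a..snd z} (H (fst z))) has_derivative
      (\<lambda>z. fst z *\<^sub>R integral {a..x} (H' x) + snd z *\<^sub>R H x x)) (at (x, x) within {a..b} \<times> {a..b})"
    by (simp add: case_prod_unfold)
  have "((\<lambda>\<xi>. integral {a..\<xi>} (H \<xi>)) has_derivative (\<lambda>t. t *\<^sub>R integral {a..x} (H' x) + t *\<^sub>R H x x))
      (at x within {a..b})"
  proof -
    have "((\<lambda>\<xi>. (\<xi>, \<xi>)) has_derivative (\<lambda>t. (t, t))) (at x within {a..b})"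
      by (auto intro!: derivative_eq_intros)
    from has_derivative_in_compose[OF this has_derivative_subset[OF D]]
    show ?thesis by auto
  qed
  then have "((\<lambda>\<xi>. integral {a..\<xi>} (H \<xi>)) has_vector_derivative H x x + integral {a..x} (H' x))
      (at x within {a..b})"
    by (simp add: has_vector_derivative_def algebra_simps)
  then have *: "((\<lambda>\<xi>. integral {a..\<xi>} (H \<xi>)) has_vector_derivative G x x + integral {a..x} (G' x))
      (at x within {a..b})"
  proof -
    have "integral {a..x} (H' x) = integral {a..x} (G' x)"
      by (rule integral_cong) (use x in \<open>auto simp: H'_def\<close>)
    moreover have "H x x = G x x" using x by (simp add: H_def)
    ultimately show "((\<lambda>\<xi>. integral {a..\<xi>} (H \<xi>)) has_vector_derivative H x x + integral {a..x} (H' x))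
      (at x within {a..b}) \<Longrightarrow> ?thesis" by simp
  qed
  show ?thesis
  proof (rule has_vector_derivative_transform[OF x _ *])
    show "integral {a..\<xi>} (G \<xi>) = integral {a..\<xi>} (H \<xi>)" if "\<xi> \<in> {a..b}" for \<xi>
      by (rule integral_cong) (use that in \<open>auto simp: H_def\<close>)
  qed
qed

lemma continuous_on_integral_snd:
  fixes f :: "real \<times> real \<Rightarrow> 'a::euclidean_space"
  assumes f: "continuous_on ({a..b} \<times> {c..d}) f"
  shows "continuous_on ({a..b} \<times> {c..d}) (\<lambda>z. integral {c..snd z} (\<lambda>y. f (fst z, y)))"
proof (rule continuous_on_integral_upper[where f = "\<lambda>z y. f (fst z, y)"])
  show "continuous_on {(z, y). z \<in> {a..b} \<times> {c..d} \<and> c \<le> y \<and> y \<le> snd z} (\<lambda>(z, y). f (fst z, y))"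
    unfolding case_prod_unfold
    by (rule continuous_on_compose2[OF f]) (auto intro!: continuous_intros)
qed (auto intro!: continuous_intros)

lemma continuous_on_integral_fst:
  fixes f :: "real \<times> real \<Rightarrow> 'a::euclidean_space"
  assumes f: "continuous_on ({a..b} \<times> {c..d}) f"
  shows "continuous_on ({a..b} \<times> {c..d}) (\<lambda>z. integral {a..fst z} (\<lambda>x. f (x, snd z)))"
proof (rule continuous_on_integral_upper[where f = "\<lambda>z x. f (x, snd z)"])
  show "continuous_on {(z, y). z \<in> {a..b} \<times> {c..d} \<and> a \<le> y \<and> y \<le> fst z} (\<lambda>(z, x). f (x, snd z))"
    unfolding case_prod_unfold
    by (rule continuous_on_compose2[OF f]) (auto intro!: continuous_intros)
qed (auto intro!: continuous_intros)

lemma continuous_on_slice: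
  assumes "continuous_on (A \<times> B) f"
  shows "y \<in> B \<Longrightarrow> continuous_on A (\<lambda>x. f (x, y))"
    and "x \<in> A \<Longrightarrow> continuous_on B (\<lambda>y. f (x, y))"
  by (auto intro!: continuous_on_compose2[OF assms] continuous_intros)

section \<open>The Goursat problem as a fixed point equation\<close>

lemma norm_double_integral_le:
  fixes f :: "real \<times> real \<Rightarrow> 'a::euclidean_space"
  assumes f: "continuous_on ({a..b} \<times> {c..d}) f"
    and le: "\<And>z. z \<in> {a..b} \<times> {c..d} \<Longrightarrow> norm (f z) \<le> K"
    and xy: "x \<in> {a..b}" "y \<in> {c..d}"
  shows "norm (integral {a..x} (\<lambda>s. integral {c..y} (\<lambda>r. f (s, r)))) \<le> K * (y - c) * (x - a)"
proof (rule integral_bound)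
  show "continuous_on {a..x} (\<lambda>s. integral {c..y} (\<lambda>r. f (s, r)))"
    using continuous_on_slice(1)[OF continuous_on_integral_snd[OF f], of y] xy
    by (auto intro: continuous_on_subset)
  show "norm (integral {c..y} (\<lambda>r. f (t, r))) \<le> K * (y - c)" if "t \<in> {a..x}" for t
  proof (rule integral_bound)
    show "continuous_on {c..y} (\<lambda>r. f (t, r))"
      using continuous_on_slice(2)[OF f, of t] xy that by (auto intro: continuous_on_subset)
  qed (use le xy that in auto)
qed (use xy in auto)

text \<open>The right-hand side is a contraction in the supremum norm: the double integral
  contributes at most the area \<open>d\<^sup>2\<close> of the rectangle, and
  \<open>B * d\<^sup>2 < 1\<close>. Banach's fixed point theorem gives the solution.\<close>

lemma goursat_solution_exists:
  fixes g :: "real \<Rightarrow> 'a::euclidean_space" and F :: "real \<times> real \<Rightarrow> 'a \<Rightarrow> 'a"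
  assumes d: "0 \<le> d" and g: "continuous_on {c..c+d} g"
    and F: "\<And>\<kappa>. continuous_on ({c..c+d} \<times> {0..d}) \<kappa> \<Longrightarrow>
              continuous_on ({c..c+d} \<times> {0..d}) (\<lambda>z. F z (\<kappa> z))"
    and lip: "\<And>z X Y. z \<in> {c..c+d} \<times> {0..d} \<Longrightarrow> norm (F z X - F z Y) \<le> B * norm (X - Y)"
    and B: "0 \<le> B" "B * d^2 < 1"
  shows "\<exists>\<kappa>. continuous_on ({c..c+d} \<times> {0..d}) \<kappa> \<and>
    (\<forall>s\<in>{c..c+d}. \<forall>r\<in>{0..d}.
       \<kappa> (s, r) = g s + integral {c..s} (\<lambda>\<sigma>. integral {0..r} (\<lambda>\<rho>. F (\<sigma>, \<rho>) (\<kappa> (\<sigma>, \<rho>)))))"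
proof -
  let ?R = "{c..c+d} \<times> {0..d}"
  define J where "J \<kappa> z = g (fst z) +
      integral {c..fst z} (\<lambda>\<sigma>. integral {0..snd z} (\<lambda>\<rho>. F (\<sigma>, \<rho>) (\<kappa> (\<sigma>, \<rho>))))" for \<kappa> z
  \<comment> \<open>The complete space used is that of bounded continuous functions on the whole
    plane; precomposing with the projection \<open>?C\<close> onto the rectangle extends
    \<open>J \<kappa>\<close> to it.\<close>
  let ?C = "clamp (c, 0) (c + d, d)"
  have cb: "cbox (c, 0) (c + d, d) = ?R"
    by (simp add: cbox_Pair_eq)
  have C: "?C z \<in> ?R" for z
  proof -
    have "(c, 0) \<bullet> i \<le> (c + d, d) \<bullet> i" if "i \<in> Basis" for i
      using that d by (auto simp: Basis_prod_def)
    then show ?thesis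
      using clamp_in_interval[of "(c, 0)" "(c + d, d)" z] by (simp add: cb)
  qed
  have J_cont: "continuous_on ?R (J \<kappa>)" if "continuous_on ?R \<kappa>" for \<kappa>
    unfolding J_def
    by (intro continuous_intros continuous_on_compose2[OF g]
        continuous_on_integral_fst[OF continuous_on_integral_snd[OF F[OF that]], simplified]) auto
  have "\<exists>h :: (real \<times> real) \<Rightarrow>\<^sub>C 'a. \<forall>z. h z = J (apply_bcontfun \<kappa>) (?C z)" for \<kappa> :: "(real \<times> real) \<Rightarrow>\<^sub>C 'a"
    using continuous_on_cbox_bcontfunE[of "(c, 0)" "(c + d, d)" "J (apply_bcontfun \<kappa>)"] J_cont[of "apply_bcontfun \<kappa>"] unfolding cb
    by (metis continuous_on_apply_bcontfun)
  then obtain \<Phi> :: "((real \<times> real) \<Rightarrow>\<^sub>C 'a) \<Rightarrow> ((real \<times> real) \<Rightarrow>\<^sub>C 'a)"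
    where \<Phi>: "\<And>\<kappa> z. \<Phi> \<kappa> z = J (apply_bcontfun \<kappa>) (?C z)"
    by metis
  have "dist (\<Phi> \<kappa>) (\<Phi> \<kappa>') \<le> B * d^2 * dist \<kappa> \<kappa>'" for \<kappa> \<kappa>'
  proof (rule dist_bound)
    fix z
    obtain s r where sr: "?C z = (s, r)" "s \<in> {c..c+d}" "r \<in> {0..d}"
      using C[of z] by (cases "?C z") auto
    note Fc = F[OF continuous_on_apply_bcontfun]
    have in1: "(\<lambda>\<rho>. F (\<sigma>, \<rho>) (apply_bcontfun \<kappa> (\<sigma>, \<rho>))) integrable_on {0..r}"
      if "\<sigma> \<in> {c..s}" for \<sigma> \<kappa>
      using continuous_on_slice(2)[OF Fc[of \<kappa>], of \<sigma>] sr that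
      by (auto intro!: integrable_continuous_real intro: continuous_on_subset)
    have in2: "(\<lambda>\<sigma>. integral {0..r} (\<lambda>\<rho>. F (\<sigma>, \<rho>) (apply_bcontfun \<kappa> (\<sigma>, \<rho>)))) integrable_on {c..s}" for \<kappa>
      using continuous_on_slice(1)[OF continuous_on_integral_snd[OF Fc[of \<kappa>]], of r] sr
      by (auto intro!: integrable_continuous_real intro: continuous_on_subset)
    have "dist (\<Phi> \<kappa> z) (\<Phi> \<kappa>' z) = norm (integral {c..s} (\<lambda>\<sigma>. integral {0..r} (\<lambda>\<rho>.
        F (\<sigma>, \<rho>) (\<kappa> (\<sigma>, \<rho>)) - F (\<sigma>, \<rho>) (\<kappa>' (\<sigma>, \<rho>)))))"
    proof -
      have "integral {c..s} (\<lambda>\<sigma>. integral {0..r} (\<lambda>\<rho>.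
          F (\<sigma>, \<rho>) (\<kappa> (\<sigma>, \<rho>)) - F (\<sigma>, \<rho>) (\<kappa>' (\<sigma>, \<rho>)))) =
        integral {c..s} (\<lambda>\<sigma>. integral {0..r} (\<lambda>\<rho>. F (\<sigma>, \<rho>) (\<kappa> (\<sigma>, \<rho>))) -
          integral {0..r} (\<lambda>\<rho>. F (\<sigma>, \<rho>) (\<kappa>' (\<sigma>, \<rho>))))"
        by (intro integral_cong integral_diff in1)
      then show ?thesis
        by (simp add: dist_norm \<Phi> J_def sr integral_diff[OF in2 in2])
    qed
    also have "\<dots> \<le> (B * dist \<kappa> \<kappa>') * (r - 0) * (s - c)"
    proof (rule norm_double_integral_le)
      show "continuous_on ?R (\<lambda>z. F z (\<kappa> z) - F z (\<kappa>' z))"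
        by (intro continuous_intros Fc)
      show "norm (F z (\<kappa> z) - F z (\<kappa>' z)) \<le> B * dist \<kappa> \<kappa>'" if "z \<in> ?R" for z
        using lip[OF that, of "\<kappa> z" "\<kappa>' z"] dist_bounded[of \<kappa> z \<kappa>'] B(1)
        by (smt (verit) dist_norm mult_left_mono)
    qed (use sr in auto)
    also have "\<dots> \<le> (B * dist \<kappa> \<kappa>') * d * d"
      using sr B by (intro mult_mono) auto
    finally show "dist (\<Phi> \<kappa> z) (\<Phi> \<kappa>' z) \<le> B * d^2 * dist \<kappa> \<kappa>'"
      by (simp add: power2_eq_square algebra_simps)
  qed
  then obtain \<kappa> where fp: "\<Phi> \<kappa> = \<kappa>"
    using banach_fix_type[of "B * d^2" \<Phi>] B by auto
  \<comment> \<open>On the rectangle the projection is the identity, so there the fixed point solves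
    the integral equation itself.\<close>
  have "\<kappa> (s, r) = J (apply_bcontfun \<kappa>) (s, r)" if "s \<in> {c..c+d}" "r \<in> {0..d}" for s r
    using \<Phi>[of \<kappa> "(s, r)"] that clamp_cancel_cbox[of "(s, r)" "(c, 0)" "(c + d, d)"]
    by (simp add: fp cb)
  then show ?thesis
    by (intro exI[of _ "apply_bcontfun \<kappa>"]) (simp add: J_def)
qed

subsection \<open>The transformation kernel\<close>

lemma integral_reflect_interval:
  fixes f :: "real \<Rightarrow> 'a::euclidean_space"
  assumes "continuous_on {a..b} f"
  shows "integral {a..b} (\<lambda>x. f (a + b - x)) = integral {a..b} f"
proof -
  have "(f has_integral integral {a..b} f) (cbox a b)"
    using integrable_continuous_real[OF assms] by (simp add: integrable_integral)
  from has_integral_affinity[OF this, of "-1" "a + b"]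
  have "((\<lambda>x. f (a + b - x)) has_integral integral {a..b} f) ((\<lambda>x. a + b - x) ` {a..b})"
    by (simp add: algebra_simps)
  moreover have "(\<lambda>x. a + b - x) ` {a..b} = {a..b}"
    by (auto intro!: image_eqI[where x = "a + b - x" for x])
  ultimately show ?thesis by (simp add: integral_unique)
qed

lemma has_vector_derivative_affine:
  fixes f :: "real \<Rightarrow> 'a::real_normed_vector"
  assumes f: "(f has_vector_derivative D) (at (m * x + b) within T)"
    and sub: "\<And>\<xi>. \<xi> \<in> S \<Longrightarrow> m * \<xi> + b \<in> T"
  shows "((\<lambda>\<xi>. f (m * \<xi> + b)) has_vector_derivative m *\<^sub>R D) (at x within S)"
proof -
  have "((\<lambda>\<xi>. m * \<xi> + b) has_vector_derivative m) (at x within S)"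
    by (auto intro!: derivative_eq_intros simp: has_vector_derivative_def)
  from vector_diff_chain_within[OF this has_vector_derivative_within_subset[OF f]]
  show ?thesis using sub by (auto simp: o_def)
qed

text \<open>
  \<open>k (s, r) = 2 K(s + r, s - r)\<close> is the kernel in characteristic coordinates, in which it solves
  \<open>\<partial>\<^sub>s \<partial>\<^sub>r k = F\<close>, \<open>k (s, 0) = g s\<close> and \<open>k (c, r) = g c\<close>; the factor 2 absorbs \<open>dy = 2 ds\<close> for fixed \<open>x = s + r\<close>.
\<close>

locale goursat_kernel = bounded_bilinear prod
  for prod :: "'a::euclidean_space \<Rightarrow> 'b::euclidean_space \<Rightarrow> 'e::euclidean_space" (infixl "\<odot>" 70) +
  fixes c d :: real and g g' :: "real \<Rightarrow> 'a" and F k :: "real \<times> real \<Rightarrow> 'a"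
  assumes F: "continuous_on ({c..c+d} \<times> {0..d}) F"
    and k_cont: "continuous_on ({c..c+d} \<times> {0..d}) k"
    and k: "\<And>s r. s \<in> {c..c+d} \<Longrightarrow> r \<in> {0..d} \<Longrightarrow>
      k (s, r) = g s + integral {c..s} (\<lambda>\<sigma>. integral {0..r} (\<lambda>\<rho>. F (\<sigma>, \<rho>)))"
    and g: "\<And>s. s \<in> {c..c+d} \<Longrightarrow> (g has_vector_derivative g' s) (at s within {c..c+d})"
begin

definition p :: "real \<times> real \<Rightarrow> 'a" where
  "p z = integral {c..fst z} (\<lambda>\<sigma>. F (\<sigma>, snd z))"

lemma p_cont: "continuous_on ({c..c+d} \<times> {0..d}) p"
  unfolding p_def by (rule continuous_on_integral_fst[OF F])

lemma p_deriv: "((\<lambda>s. p (s, r)) has_vector_derivative F (s, r)) (at s within {c..c+d})"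
  if "s \<in> {c..c+d}" "r \<in> {0..d}"
  unfolding p_def using integral_has_vector_derivative[OF continuous_on_slice(1)[OF F]] that by simp

lemma k_deriv: "((\<lambda>r. k (s, r)) has_vector_derivative p (s, r)) (at r within {0..d})"
  if s: "s \<in> {c..c+d}" and r: "r \<in> {0..d}"
proof -
  have "((\<lambda>r. integral (cbox c s) (\<lambda>\<sigma>. integral {0..r} (\<lambda>\<rho>. F (\<sigma>, \<rho>))))
      has_vector_derivative integral (cbox c s) (\<lambda>\<sigma>. F (\<sigma>, r))) (at r within {0..d})"
  proof (rule leibniz_rule_vector_derivative)
    show "((\<lambda>r. integral {0..r} (\<lambda>\<rho>. F (t, \<rho>))) has_vector_derivative F (t, x)) (at x within {0..d})"
      if "x \<in> {0..d}" "t \<in> cbox c s" for x t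
      using integral_has_vector_derivative[OF continuous_on_slice(2)[OF F, of t] that(1)] s that by simp
    show "(\<lambda>\<sigma>. integral {0..x} (\<lambda>\<rho>. F (\<sigma>, \<rho>))) integrable_on cbox c s" if "x \<in> {0..d}" for x
      using continuous_on_slice(1)[OF continuous_on_integral_snd[OF F] that] s
      by (auto intro!: integrable_continuous_real intro: continuous_on_subset)
    show "continuous_on ({0..d} \<times> cbox c s) (\<lambda>(x, t). F (t, x))"
      unfolding case_prod_unfold
      by (rule continuous_on_compose2[OF F]) (use s in \<open>auto intro!: continuous_intros\<close>)
  qed (use r in auto)
  then have "((\<lambda>r. g s + integral {c..s} (\<lambda>\<sigma>. integral {0..r} (\<lambda>\<rho>. F (\<sigma>, \<rho>))))
      has_vector_derivative p (s, r)) (at r within {0..d})"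
    by (auto intro!: derivative_eq_intros simp: p_def)
  from has_vector_derivative_transform[OF r _ this] k[OF s] show ?thesis by simp
qed

lemma k_0: "s \<in> {c..c+d} \<Longrightarrow> k (s, 0) = g s" if "0 \<le> d"
  using k[of s 0] that by simp

text \<open>On the line \<open>s + r = x\<close> one has \<open>r = x - s\<close> and
  \<open>y = s - r = 2 * s - x\<close>. For \<open>c \<le> s \<le> x \<le> c + d\<close> these stay
  in \<open>{0..d}\<close> and \<open>{c-d..c+d}\<close>, so the integrand of the kernel transform
  makes sense on the triangle.\<close>

lemma triangle_cont:
  assumes h: "continuous_on ({c..c+d} \<times> {0..d}) h" and a: "continuous_on {c-d..c+d} a"
  shows "continuous_on {(x, s). c \<le> s \<and> s \<le> x \<and> x \<le> c + d} (\<lambda>(x, s). h (s, x - s) \<odot> a (2 * s - x))"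
  unfolding case_prod_unfold
  by (intro continuous_on continuous_on_compose2[OF h] continuous_on_compose2[OF a])
     (auto intro!: continuous_intros)

lemma triangle_slice:
  assumes h: "continuous_on ({c..c+d} \<times> {0..d}) h" and a: "continuous_on {c-d..c+d} a"
    and x: "x \<in> {c..c+d}"
  shows "continuous_on {c..x} (\<lambda>s. h (s, x - s) \<odot> a (2 * s - x))"
  by (intro continuous_on continuous_on_compose2[OF h] continuous_on_compose2[OF a])
     (use x in \<open>auto intro!: continuous_intros\<close>)

text \<open>At fixed \<open>s\<close> the variable \<open>x\<close> enters through
  \<open>r = x - s\<close>, giving \<open>p\<close>, and through \<open>y = 2 * s - x\<close>,
  giving \<open>- a'\<close>. The boundary term sits at \<open>s = x\<close>, that is
  \<open>r = 0\<close>, where \<open>k\<close> equals \<open>g\<close>.\<close>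

lemma integral_k_deriv:
  assumes a: "\<And>y. y \<in> {c-d..c+d} \<Longrightarrow> (a has_vector_derivative a' y) (at y within {c-d..c+d})"
    and a': "continuous_on {c-d..c+d} a'" and x: "x \<in> {c..c+d}"
  shows "((\<lambda>x. integral {c..x} (\<lambda>s. k (s, x - s) \<odot> a (2 * s - x))) has_vector_derivative
     g x \<odot> a x + integral {c..x} (\<lambda>s. p (s, x - s) \<odot> a (2 * s - x) - k (s, x - s) \<odot> a' (2 * s - x)))
     (at x within {c..c+d})"
proof -
  have a_cont: "continuous_on {c-d..c+d} a"
    by (rule continuous_on_vector_derivative[OF a])
  have "((\<lambda>x. integral {c..x} (\<lambda>s. k (s, x - s) \<odot> a (2 * s - x))) has_vector_derivative
     k (x, x - x) \<odot> a (2 * x - x) +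
       integral {c..x} (\<lambda>s. p (s, x - s) \<odot> a (2 * s - x) - k (s, x - s) \<odot> a' (2 * s - x)))
     (at x within {c..c+d})"
  proof (rule has_vector_derivative_integral_triangle)
    show "continuous_on {(x, y). c \<le> y \<and> y \<le> x \<and> x \<le> c + d}
        (\<lambda>(x, s). p (s, x - s) \<odot> a (2 * s - x) - k (s, x - s) \<odot> a' (2 * s - x))"
      using continuous_on_diff[OF triangle_cont[OF p_cont a_cont] triangle_cont[OF k_cont a']]
      by (simp add: case_prod_unfold)
    show "continuous_on {(x, y). c \<le> y \<and> y \<le> x \<and> x \<le> c + d} (\<lambda>(x, s). k (s, x - s) \<odot> a (2 * s - x))"
      by (rule triangle_cont[OF k_cont a_cont])
    show "((\<lambda>x. k (s, x - s) \<odot> a (2 * s - x)) has_vector_derivative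
        p (s, x - s) \<odot> a (2 * s - x) - k (s, x - s) \<odot> a' (2 * s - x)) (at x within {s..c+d})"
      if "c \<le> s" "s \<le> x" "x \<le> c + d" for x s
    proof -
      have 1: "((\<lambda>x. k (s, 1 * x + - s)) has_vector_derivative 1 *\<^sub>R p (s, x - s)) (at x within {s..c+d})"
        by (rule has_vector_derivative_affine[where T = "{0..d}"]) (use that k_deriv[of s "x - s"] in auto)
      have 2: "((\<lambda>x. a (-1 * x + 2 * s)) has_vector_derivative -1 *\<^sub>R a' (2 * s - x)) (at x within {s..c+d})"
        by (rule has_vector_derivative_affine[where T = "{c-d..c+d}"]) (use that a[of "2 * s - x"] in auto)
      show ?thesis
        using has_vector_derivative[OF 1 2] by (simp add: minus_right)
    qed
  qed (use x in auto)
  then show ?thesis using k_0[of x] x by simp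
qed

text \<open>Differentiating \<open>p (s, x - s)\<close> at fixed \<open>s\<close> would require the
  missing derivative in \<open>r\<close>. The reflection \<open>\<tau> = x + c - s\<close> keeps
  \<open>r = \<tau> - c\<close> fixed instead, so that \<open>x\<close> occurs only in the first
  argument of \<open>p\<close>, where the derivative is \<open>F\<close>.\<close>

lemma integral_p_deriv:
  assumes a: "\<And>y. y \<in> {c-d..c+d} \<Longrightarrow> (a has_vector_derivative a' y) (at y within {c-d..c+d})"
    and a': "continuous_on {c-d..c+d} a'" and x: "x \<in> {c..c+d}"
  shows "((\<lambda>x. integral {c..x} (\<lambda>s. p (s, x - s) \<odot> a (2 * s - x))) has_vector_derivative
     integral {c..x} (\<lambda>s. F (s, x - s) \<odot> a (2 * s - x) + p (s, x - s) \<odot> a' (2 * s - x)))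
     (at x within {c..c+d})"
proof -
  have a_cont: "continuous_on {c-d..c+d} a"
    by (rule continuous_on_vector_derivative[OF a])
  have refl: "integral {c..x} (\<lambda>\<tau>. h (x + c - \<tau>, \<tau> - c) \<odot> b (x + 2 * c - 2 * \<tau>)) =
       integral {c..x} (\<lambda>s. h (s, x - s) \<odot> b (2 * s - x))"
    if "x \<in> {c..c+d}" "continuous_on ({c..c+d} \<times> {0..d}) h" "continuous_on {c-d..c+d} b" for x h b
  proof -
    have "integral {c..x} (\<lambda>\<tau>. h (c + x - \<tau>, x - (c + x - \<tau>)) \<odot> b (2 * (c + x - \<tau>) - x)) =
       integral {c..x} (\<lambda>s. h (s, x - s) \<odot> b (2 * s - x))"
      by (rule integral_reflect_interval[OF triangle_slice[OF that(2,3,1)]])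
    then show ?thesis by (simp add: algebra_simps)
  qed
  have tc: "continuous_on {(x, s). c \<le> s \<and> s \<le> x \<and> x \<le> c + d}
      (\<lambda>(x, \<tau>). h (x + c - \<tau>, \<tau> - c) \<odot> b (x + 2 * c - 2 * \<tau>))"
    if "continuous_on ({c..c+d} \<times> {0..d}) h" "continuous_on {c-d..c+d} b" for h b
    unfolding case_prod_unfold
    by (intro continuous_on continuous_on_compose2[OF that(1)] continuous_on_compose2[OF that(2)])
      (auto intro!: continuous_intros)
  have "((\<lambda>x. integral {c..x} (\<lambda>\<tau>. p (x + c - \<tau>, \<tau> - c) \<odot> a (x + 2 * c - 2 * \<tau>))) has_vector_derivative
     p (x + c - x, x - c) \<odot> a (x + 2 * c - 2 * x) +
     integral {c..x} (\<lambda>\<tau>. F (x + c - \<tau>, \<tau> - c) \<odot> a (x + 2 * c - 2 * \<tau>) +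
       p (x + c - \<tau>, \<tau> - c) \<odot> a' (x + 2 * c - 2 * \<tau>)))
     (at x within {c..c+d})"
  proof (rule has_vector_derivative_integral_triangle)
    show "continuous_on {(x, y). c \<le> y \<and> y \<le> x \<and> x \<le> c + d}
        (\<lambda>(x, \<tau>). F (x + c - \<tau>, \<tau> - c) \<odot> a (x + 2 * c - 2 * \<tau>) +
          p (x + c - \<tau>, \<tau> - c) \<odot> a' (x + 2 * c - 2 * \<tau>))"
      using continuous_on_add[OF tc[OF F a_cont] tc[OF p_cont a']] by (simp add: case_prod_unfold)
    show "continuous_on {(x, y). c \<le> y \<and> y \<le> x \<and> x \<le> c + d}
        (\<lambda>(x, \<tau>). p (x + c - \<tau>, \<tau> - c) \<odot> a (x + 2 * c - 2 * \<tau>))"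
      by (rule tc[OF p_cont a_cont])
    show "((\<lambda>x. p (x + c - \<tau>, \<tau> - c) \<odot> a (x + 2 * c - 2 * \<tau>)) has_vector_derivative
        F (x + c - \<tau>, \<tau> - c) \<odot> a (x + 2 * c - 2 * \<tau>) + p (x + c - \<tau>, \<tau> - c) \<odot> a' (x + 2 * c - 2 * \<tau>))
        (at x within {\<tau>..c+d})"
      if "c \<le> \<tau>" "\<tau> \<le> x" "x \<le> c + d" for x \<tau>
    proof -
      have 1: "((\<lambda>x. p (1 * x + (c - \<tau>), \<tau> - c)) has_vector_derivative 1 *\<^sub>R F (x + c - \<tau>, \<tau> - c))
          (at x within {\<tau>..c+d})"
        by (rule has_vector_derivative_affine[where T = "{c..c+d}" and f = "\<lambda>x. p (x, \<tau> - c)"])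
          (use that p_deriv[of "x + c - \<tau>" "\<tau> - c"] in \<open>auto simp: algebra_simps\<close>)
      have 2: "((\<lambda>x. a (1 * x + (2 * c - 2 * \<tau>))) has_vector_derivative 1 *\<^sub>R a' (x + 2 * c - 2 * \<tau>))
          (at x within {\<tau>..c+d})"
        by (rule has_vector_derivative_affine[where T = "{c-d..c+d}"])
          (use that a[of "x + 2 * c - 2 * \<tau>"] in \<open>auto simp: algebra_simps\<close>)
      show ?thesis
        using has_vector_derivative[OF 1 2] by (simp add: algebra_simps)
    qed
  qed (use x in auto)
  \<comment> \<open>The moving end \<open>\<tau> = x\<close> corresponds to \<open>s = c\<close>,
    the edge of the cone on which \<open>k\<close> is constant in \<open>r\<close>; hence there is
    no boundary term.\<close>
  moreover have "p (c, x - c) = 0" by (simp add: p_def)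
  moreover have "integral {c..x} (\<lambda>\<tau>. F (x + c - \<tau>, \<tau> - c) \<odot> a (x + 2 * c - 2 * \<tau>) +
       p (x + c - \<tau>, \<tau> - c) \<odot> a' (x + 2 * c - 2 * \<tau>)) =
     integral {c..x} (\<lambda>s. F (s, x - s) \<odot> a (2 * s - x) + p (s, x - s) \<odot> a' (2 * s - x))"
  proof -
    have i: "(\<lambda>s. h (s, x - s) \<odot> b (2 * s - x)) integrable_on {c..x}"
      "(\<lambda>\<tau>. h (x + c - \<tau>, \<tau> - c) \<odot> b (x + 2 * c - 2 * \<tau>)) integrable_on {c..x}"
      if "continuous_on ({c..c+d} \<times> {0..d}) h" "continuous_on {c-d..c+d} b" for h b
    proof -
      show "(\<lambda>s. h (s, x - s) \<odot> b (2 * s - x)) integrable_on {c..x}"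
        by (rule integrable_continuous_real[OF triangle_slice[OF that x]])
      show "(\<lambda>\<tau>. h (x + c - \<tau>, \<tau> - c) \<odot> b (x + 2 * c - 2 * \<tau>)) integrable_on {c..x}"
        by (rule integrable_continuous_real, rule continuous_on_compose2[OF tc[OF that],
            where f = "\<lambda>\<tau>. (x, \<tau>)", simplified]) (use x in \<open>auto intro!: continuous_intros\<close>)
    qed
    show ?thesis
      by (simp add: integral_add i F p_cont a_cont a' refl[OF x F a_cont] refl[OF x p_cont a'])
  qed
  ultimately have D: "((\<lambda>x. integral {c..x} (\<lambda>\<tau>. p (x + c - \<tau>, \<tau> - c) \<odot> a (x + 2 * c - 2 * \<tau>)))
     has_vector_derivative
     integral {c..x} (\<lambda>s. F (s, x - s) \<odot> a (2 * s - x) + p (s, x - s) \<odot> a' (2 * s - x)))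
     (at x within {c..c+d})"
    by (simp add: zero_left)
  show ?thesis
    by (rule has_vector_derivative_transform[OF x _ D]) (simp add: refl p_cont a_cont)
qed

text \<open>The differentiated expression is the first derivative of the kernel transform. Both
  \<open>g x \<odot> a' x\<close> and the integral of \<open>p\<close> against \<open>a'\<close>
  arise twice with opposite signs and cancel, so the second derivative contains only
  \<open>g'\<close>, \<open>F\<close> and \<open>k\<close>.\<close>

lemma integral_k_deriv2:
  assumes a: "\<And>y. y \<in> {c-d..c+d} \<Longrightarrow> (a has_vector_derivative a' y) (at y within {c-d..c+d})"
    and a': "\<And>y. y \<in> {c-d..c+d} \<Longrightarrow> (a' has_vector_derivative a'' y) (at y within {c-d..c+d})"
    and a'': "continuous_on {c-d..c+d} a''" and x: "x \<in> {c..c+d}"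
  shows "((\<lambda>x. g x \<odot> a x +
        integral {c..x} (\<lambda>s. p (s, x - s) \<odot> a (2 * s - x) - k (s, x - s) \<odot> a' (2 * s - x)))
     has_vector_derivative
        g' x \<odot> a x + integral {c..x} (\<lambda>s. F (s, x - s) \<odot> a (2 * s - x) + k (s, x - s) \<odot> a'' (2 * s - x)))
     (at x within {c..c+d})"
proof -
  have d: "0 \<le> d" using x by simp
  have a_cont: "continuous_on {c-d..c+d} a" and a'_cont: "continuous_on {c-d..c+d} a'"
    by (auto intro: continuous_on_vector_derivative[OF a] continuous_on_vector_derivative[OF a'])
  note int = integrable_continuous_real[OF triangle_slice]
  have ga: "((\<lambda>x. g x \<odot> a x) has_vector_derivative g x \<odot> a' x + g' x \<odot> a x) (at x within {c..c+d})"
    by (rule has_vector_derivative[OF g[OF x] has_vector_derivative_within_subset[OF a]])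
      (use x d in auto)
  have "((\<lambda>x. g x \<odot> a x + (integral {c..x} (\<lambda>s. p (s, x - s) \<odot> a (2 * s - x)) -
        integral {c..x} (\<lambda>s. k (s, x - s) \<odot> a' (2 * s - x)))) has_vector_derivative
     (g x \<odot> a' x + g' x \<odot> a x) +
     (integral {c..x} (\<lambda>s. F (s, x - s) \<odot> a (2 * s - x) + p (s, x - s) \<odot> a' (2 * s - x)) -
      (g x \<odot> a' x + integral {c..x} (\<lambda>s. p (s, x - s) \<odot> a' (2 * s - x) - k (s, x - s) \<odot> a'' (2 * s - x)))))
     (at x within {c..c+d})"
    by (intro has_vector_derivative_add has_vector_derivative_diff ga
        integral_p_deriv[OF a a'_cont x] integral_k_deriv[OF a' a'' x])
  moreover have "(g x \<odot> a' x + g' x \<odot> a x) +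
     (integral {c..x} (\<lambda>s. F (s, x - s) \<odot> a (2 * s - x) + p (s, x - s) \<odot> a' (2 * s - x)) -
      (g x \<odot> a' x + integral {c..x} (\<lambda>s. p (s, x - s) \<odot> a' (2 * s - x) - k (s, x - s) \<odot> a'' (2 * s - x)))) =
    g' x \<odot> a x + integral {c..x} (\<lambda>s. F (s, x - s) \<odot> a (2 * s - x) + k (s, x - s) \<odot> a'' (2 * s - x))"
    by (simp add: integral_add[OF int[OF F a_cont x] int[OF p_cont a'_cont x]]
        integral_add[OF int[OF F a_cont x] int[OF k_cont a'' x]]
        integral_diff[OF int[OF p_cont a'_cont x] int[OF k_cont a'' x]])
  ultimately have D: "((\<lambda>x. g x \<odot> a x + (integral {c..x} (\<lambda>s. p (s, x - s) \<odot> a (2 * s - x)) -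
        integral {c..x} (\<lambda>s. k (s, x - s) \<odot> a' (2 * s - x)))) has_vector_derivative
    g' x \<odot> a x + integral {c..x} (\<lambda>s. F (s, x - s) \<odot> a (2 * s - x) + k (s, x - s) \<odot> a'' (2 * s - x)))
     (at x within {c..c+d})"
    by simp
  show ?thesis
    by (rule has_vector_derivative_transform[OF x _ D])
      (simp add: integral_diff[OF int[OF p_cont a_cont] int[OF k_cont a'_cont]])
qed

end

subsection \<open>Sideways uniqueness\<close>

text \<open>Taylor's formula with integral remainder: \<open>(x - y) *\<^sub>R f' y + f y\<close> is
  a primitive of the integrand in \<open>y\<close>. It turns a second order equation with zero
  Cauchy data at \<open>a\<close> into a Volterra equation.\<close>

lemma has_integral_taylor2:
  fixes f :: "real \<Rightarrow> 'a::euclidean_space"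
  assumes f: "\<And>y. y \<in> {a..b} \<Longrightarrow> (f has_vector_derivative f' y) (at y within {a..b})"
    and f': "\<And>y. y \<in> {a..b} \<Longrightarrow> (f' has_vector_derivative f'' y) (at y within {a..b})"
    and zero: "f a = 0" "f' a = 0" and x: "x \<in> {a..b}"
  shows "((\<lambda>y. (x - y) *\<^sub>R f'' y) has_integral f x) {a..x}"
proof -
  have "((\<lambda>y. (x - y) *\<^sub>R f' y + f y) has_vector_derivative (x - y) *\<^sub>R f'' y) (at y within {a..x})"
    if "y \<in> {a..x}" for y
  proof -
    have y: "y \<in> {a..b}" "{a..x} \<subseteq> {a..b}" using that x by auto
    have "((\<lambda>y. (x - y) *\<^sub>R f' y + f y) has_vector_derivative
        ((x - y) *\<^sub>R f'' y + (-1) *\<^sub>R f' y) + f' y) (at y within {a..x})"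
      by (intro has_vector_derivative_add has_vector_derivative_scaleR
          has_vector_derivative_within_subset[OF f[OF y(1)] y(2)]
          has_vector_derivative_within_subset[OF f'[OF y(1)] y(2)])
        (auto intro!: derivative_eq_intros)
    then show ?thesis by simp
  qed
  from fundamental_theorem_of_calculus[OF _ this] x zero show ?thesis by simp
qed

text \<open>In the norm weighted by \<open>exp (- L * (y - a))\<close> the double integration gains
  a factor \<open>1 / L\<^sup>2\<close>, so at most half of the left side returns through
  \<open>q\<close> and is absorbed. What remains is the twofold integral of the source, which raises
  the power and the factorial by two.\<close>

lemma double_integral_gronwall:
  fixes Y :: "real \<Rightarrow> 'a::euclidean_space"
  assumes Y: "continuous_on {a..b} Y" and q: "0 \<le> q" and C: "0 \<le> C"
    and le: "\<And>x. x \<in> {a..b} \<Longrightarrow>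
      norm (Y x) \<le> integral {a..x} (\<lambda>y. (x - y) * (q * norm (Y y) + C * ((y - a) ^ n / fact n)))"
    and x: "x \<in> {a..b}"
  shows "norm (Y x) \<le> 2 * exp ((2 * q + 1) * (b - a)) * C * ((x - a) ^ (n + 2) / fact (n + 2))"
proof -
  \<comment> \<open>Any positive \<open>L\<close> with \<open>2 * q \<le> L\<^sup>2\<close> would
    serve; this choice avoids a square root and a separate case \<open>q = 0\<close>.\<close>
  define L where "L = 2 * q + 1"
  have L: "0 < L" "2 * q \<le> L\<^sup>2" using q by (auto simp: L_def power2_eq_square algebra_simps)
  have int_pow: "((\<lambda>y. (x - y) * ((y - a) ^ n / fact n)) has_integral (x - a) ^ (n + 2) / fact (n + 2)) {a..x}"
    if "x \<in> {a..b}" for x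
  proof -
    have "((\<lambda>y. (x - y) *\<^sub>R ((y - a) ^ n / fact n)) has_integral (x - a) ^ (n + 2) / fact (n + 2)) {a..x}"
    proof (rule has_integral_taylor2[where f = "\<lambda>y. (y - a) ^ (n + 2) / fact (n + 2)"
            and f' = "\<lambda>y. (y - a) ^ (n + 1) / fact (n + 1)"])
      have "((\<lambda>y. (y - a) ^ Suc k / fact (Suc k)) has_real_derivative (y - a) ^ k / fact k) (at y within {a..b})" for k y
        by (auto intro!: derivative_eq_intros simp: field_simps simp del: power_Suc of_nat_Suc)
      note D = this[unfolded has_real_derivative_iff_has_vector_derivative]
      show "((\<lambda>y. (y - a) ^ (n + 2) / fact (n + 2)) has_vector_derivative (y - a) ^ (n + 1) / fact (n + 1))
          (at y within {a..b})" for y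
        using D[of "n + 1"] by simp
      show "((\<lambda>y. (y - a) ^ (n + 1) / fact (n + 1)) has_vector_derivative (y - a) ^ n / fact n)
          (at y within {a..b})" for y
        using D[of n] by simp
    qed (use that in auto)
    then show ?thesis by simp
  qed
  have int_exp: "((\<lambda>y. (x - y) * exp (L * (y - a))) has_integral
      exp (L * (x - a)) / L\<^sup>2 - (1 / L\<^sup>2 + (x - a) / L)) {a..x}" if "x \<in> {a..b}" for x
  proof -
    have "((\<lambda>y. (x - y) *\<^sub>R exp (L * (y - a))) has_integral
      exp (L * (x - a)) / L\<^sup>2 - (1 / L\<^sup>2 + (x - a) / L)) {a..x}"
      by (rule has_integral_taylor2[where f' = "\<lambda>y. exp (L * (y - a)) / L - 1 / L"])
        (use L(1) that in \<open>auto intro!: derivative_eq_intros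
          simp: has_real_derivative_iff_has_vector_derivative[symmetric] power2_eq_square field_simps\<close>)
    then show ?thesis by simp
  qed
  have Yx: "continuous_on {a..x} Y" using Y x by (auto intro: continuous_on_subset)
  then have "continuous_on {a..x} (\<lambda>y. exp (- L * (y - a)) * norm (Y y))"
    by (intro continuous_intros)
  \<comment> \<open>The maximum is taken up to the given \<open>x\<close> and not up to
    \<open>b\<close>, so that the final bound retains the power of \<open>x - a\<close>.\<close>
  from continuous_attains_sup[OF _ _ this] x obtain y0 where y0: "y0 \<in> {a..x}"
    and max: "\<And>y. y \<in> {a..x} \<Longrightarrow> exp (- L * (y - a)) * norm (Y y) \<le> exp (- L * (y0 - a)) * norm (Y y0)"
    by auto
  define M where "M = exp (- L * (y0 - a)) * norm (Y y0)"
  have M0: "0 \<le> M" by (simp add: M_def)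
  have M: "norm (Y y) \<le> M * exp (L * (y - a))" if "y \<in> {a..x}" for y
  proof -
    have "norm (Y y) = exp (L * (y - a)) * (exp (- L * (y - a)) * norm (Y y))"
      by (simp add: exp_minus)
    also have "\<dots> \<le> exp (L * (y - a)) * M"
      using max[OF that] by (intro mult_left_mono) (auto simp: M_def)
    finally show ?thesis by (simp add: mult.commute)
  qed
  have y0b: "y0 \<in> {a..b}" using y0 x by auto
  have pow_le: "(y0 - a) ^ (n + 2) / fact (n + 2) \<le> (x - a) ^ (n + 2) / (fact (n + 2) :: real)"
    using y0 by (intro divide_right_mono power_mono) auto
  have "norm (Y y0) \<le> integral {a..y0} (\<lambda>y. (y0 - y) * (q * norm (Y y) + C * ((y - a) ^ n / fact n)))"
    by (rule le[OF y0b])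
  also have "\<dots> \<le> q * M * (exp (L * (y0 - a)) / L\<^sup>2 - (1 / L\<^sup>2 + (y0 - a) / L)) +
      C * ((y0 - a) ^ (n + 2) / fact (n + 2))"
  proof (rule has_integral_le[OF integrable_integral])
    show "(\<lambda>y. (y0 - y) * (q * norm (Y y) + C * ((y - a) ^ n / fact n))) integrable_on {a..y0}"
      by (intro integrable_continuous_real continuous_intros continuous_on_subset[OF Yx]) (use y0 in auto)
    show "((\<lambda>y. q * M * ((y0 - y) * exp (L * (y - a))) + C * ((y0 - y) * ((y - a) ^ n / fact n))) has_integral
        q * M * (exp (L * (y0 - a)) / L\<^sup>2 - (1 / L\<^sup>2 + (y0 - a) / L)) +
        C * ((y0 - a) ^ (n + 2) / fact (n + 2))) {a..y0}"
      by (intro has_integral_add has_integral_mult_right int_pow int_exp y0b)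
    show "(y0 - y) * (q * norm (Y y) + C * ((y - a) ^ n / fact n))
        \<le> q * M * ((y0 - y) * exp (L * (y - a))) + C * ((y0 - y) * ((y - a) ^ n / fact n))"
      if "y \<in> {a..y0}" for y
    proof -
      have "(y0 - y) * (q * norm (Y y)) \<le> (y0 - y) * (q * (M * exp (L * (y - a))))"
        using M[of y] that y0 q by (intro mult_left_mono) auto
      then show ?thesis by (simp add: algebra_simps)
    qed
  qed
  also have "\<dots> \<le> q * M * (exp (L * (y0 - a)) / L\<^sup>2) + C * ((x - a) ^ (n + 2) / fact (n + 2))"
  proof (intro add_mono mult_left_mono)
    have "0 \<le> 1 / L\<^sup>2 + (y0 - a) / L" using L y0 by simp
    then show "exp (L * (y0 - a)) / L\<^sup>2 - (1 / L\<^sup>2 + (y0 - a) / L) \<le> exp (L * (y0 - a)) / L\<^sup>2" by simp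
  qed (use q M0 C pow_le in auto)
  finally have "norm (Y y0) \<le> q * M * (exp (L * (y0 - a)) / L\<^sup>2) + C * ((x - a) ^ (n + 2) / fact (n + 2))" .
  then have "M \<le> exp (- L * (y0 - a)) * (q * M * (exp (L * (y0 - a)) / L\<^sup>2) + C * ((x - a) ^ (n + 2) / fact (n + 2)))"
    unfolding M_def by (rule mult_left_mono) simp
  also have "\<dots> = (exp (- L * (y0 - a)) * exp (L * (y0 - a))) * (M * (q / L\<^sup>2)) +
      exp (- L * (y0 - a)) * (C * ((x - a) ^ (n + 2) / fact (n + 2)))"
    by (simp add: distrib_left mult_ac)
  also have "exp (- L * (y0 - a)) * exp (L * (y0 - a)) = 1"
    by (simp flip: exp_add)
  also have "1 * (M * (q / L\<^sup>2)) + exp (- L * (y0 - a)) * (C * ((x - a) ^ (n + 2) / fact (n + 2)))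
      \<le> M * (1 / 2) + 1 * (C * ((x - a) ^ (n + 2) / fact (n + 2)))"
  proof -
    have "q / L\<^sup>2 \<le> 1 / 2" using L by (simp add: field_simps)
    moreover have "exp (- L * (y0 - a)) \<le> 1" using L y0 by simp
    moreover have "0 \<le> C * ((x - a) ^ (n + 2) / fact (n + 2))" using C x by auto
    ultimately show ?thesis
      unfolding mult_1_left[of "M * (q / L\<^sup>2)"] using M0
      by (intro add_mono mult_left_mono[of "q / L\<^sup>2"] mult_right_mono[of "exp (- L * (y0 - a))"])
  qed
  finally have M2: "M \<le> 2 * (C * ((x - a) ^ (n + 2) / fact (n + 2)))" by simp
  have "norm (Y x) \<le> M * exp (L * (x - a))" using M[of x] x by simp
  also have "\<dots> \<le> (2 * (C * ((x - a) ^ (n + 2) / fact (n + 2)))) * exp (L * (b - a))"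
    using M2 M0 L x C by (intro mult_mono) auto
  finally show ?thesis by (simp add: L_def mult_ac)
qed

text \<open>If \<open>\<psi> t0\<close> were positive, the weight
  \<open>h\<^sup>2 - (t - t0)\<^sup>2\<close>, which is largest at \<open>t0\<close>, would make the
  moments at least of order \<open>\<rho> ^ n\<close> for some \<open>\<rho> > 0\<close>. The
  assumed bound decays faster than every geometric sequence.\<close>

lemma landau_kernel_moments:
  fixes \<psi> :: "real \<Rightarrow> real"
  assumes h: "0 < h" and \<psi>: "continuous_on {t0-h..t0+h} \<psi>"
    and le: "\<And>n. integral {t0-h..t0+h} (\<lambda>t. (h\<^sup>2 - (t - t0)\<^sup>2) ^ n * \<psi> t) \<le> C * (D ^ n / fact n)"
  shows "\<psi> t0 \<le> 0"
proof (rule ccontr)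
  assume "\<not> \<psi> t0 \<le> 0"
  then have pos: "0 < \<psi> t0" by simp
  define c where "c = \<psi> t0 / 2"
  obtain e where e: "0 < e" "\<And>t. t \<in> {t0-h..t0+h} \<Longrightarrow> \<bar>t - t0\<bar> < e \<Longrightarrow> \<bar>\<psi> t - \<psi> t0\<bar> < c"
  proof -
    have "t0 \<in> {t0-h..t0+h}" "0 < c" using h pos by (auto simp: c_def)
    with \<psi>[unfolded continuous_on_iff dist_real_def] that show ?thesis by blast
  qed
  define \<eta> where "\<eta> = min (e / 2) (h / 2)"
  have \<eta>: "0 < \<eta>" "\<eta> < h" "\<eta> < e" using e h by (auto simp: \<eta>_def)
  have c: "0 < c" "\<And>t. \<bar>t - t0\<bar> \<le> \<eta> \<Longrightarrow> c \<le> \<psi> t"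
  proof -
    show "0 < c" using pos by (simp add: c_def)
    show "c \<le> \<psi> t" if "\<bar>t - t0\<bar> \<le> \<eta>" for t
    proof -
      have "\<bar>\<psi> t - \<psi> t0\<bar> < c"
        by (rule e(2)) (use that \<eta> in auto)
      then show ?thesis unfolding c_def by linarith
    qed
  qed
  have "bounded (\<psi> ` {t0-h..t0+h})"
    by (intro compact_imp_bounded compact_continuous_image \<psi>) simp
  then obtain M where M: "0 < M" "\<And>t. t \<in> {t0-h..t0+h} \<Longrightarrow> \<bar>\<psi> t\<bar> \<le> M"
    unfolding bounded_pos by auto
  define \<rho> where "\<rho> = h\<^sup>2 - (\<eta> / 2)\<^sup>2"
  define \<theta> where "\<theta> = h\<^sup>2 - \<eta>\<^sup>2"
  have "\<eta>\<^sup>2 < h\<^sup>2" using \<eta> by (intro power_strict_mono) auto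
  then have \<theta>: "0 < \<theta>" "\<theta> < \<rho>" using \<eta> by (auto simp: \<theta>_def \<rho>_def power2_eq_square)
  have key: "c * \<eta> \<le> 2 * h * M * (\<theta> / \<rho>) ^ n + C * (inverse (fact n) * (D / \<rho>) ^ n)" for n
  proof -
    have "((\<lambda>t. (if t \<in> {t0 - \<eta>/2..t0 + \<eta>/2} then c * \<rho> ^ n else 0) - M * \<theta> ^ n) has_integral
        c * \<rho> ^ n * \<eta> - M * \<theta> ^ n * (2 * h)) {t0-h..t0+h}"
    proof (rule has_integral_diff)
      show "((\<lambda>t. if t \<in> {t0 - \<eta>/2..t0 + \<eta>/2} then c * \<rho> ^ n else 0) has_integral c * \<rho> ^ n * \<eta>) {t0-h..t0+h}"
        using has_integral_const_real[of "c * \<rho> ^ n" "t0 - \<eta>/2" "t0 + \<eta>/2"] \<eta>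
        by (subst has_integral_restrict) (auto simp: mult.commute)
      show "((\<lambda>t. M * \<theta> ^ n) has_integral M * \<theta> ^ n * (2 * h)) {t0-h..t0+h}"
        using has_integral_const_real[of "M * \<theta> ^ n" "t0 - h" "t0 + h"] h by (simp add: mult.commute)
    qed
    moreover have "((\<lambda>t. (h\<^sup>2 - (t - t0)\<^sup>2) ^ n * \<psi> t) has_integral
        integral {t0-h..t0+h} (\<lambda>t. (h\<^sup>2 - (t - t0)\<^sup>2) ^ n * \<psi> t)) {t0-h..t0+h}"
      by (intro integrable_integral integrable_continuous_real continuous_intros \<psi>)
    ultimately have "c * \<rho> ^ n * \<eta> - M * \<theta> ^ n * (2 * h) \<le>
        integral {t0-h..t0+h} (\<lambda>t. (h\<^sup>2 - (t - t0)\<^sup>2) ^ n * \<psi> t)"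
    proof (rule has_integral_le)
      fix t assume t: "t \<in> {t0-h..t0+h}"
      have sq: "(t - t0)\<^sup>2 \<le> s\<^sup>2 \<longleftrightarrow> \<bar>t - t0\<bar> \<le> s" if "0 < s" for s
        using abs_le_square_iff[of "t - t0" s] that by simp
      have w0: "0 \<le> h\<^sup>2 - (t - t0)\<^sup>2" using sq[OF h] t by (simp add: abs_le_iff)
      consider "\<bar>t - t0\<bar> \<le> \<eta>/2" | "\<eta>/2 < \<bar>t - t0\<bar>" "\<bar>t - t0\<bar> \<le> \<eta>" | "\<eta> < \<bar>t - t0\<bar>" by linarith
      then show "(if t \<in> {t0 - \<eta>/2..t0 + \<eta>/2} then c * \<rho> ^ n else 0) - M * \<theta> ^ n
          \<le> (h\<^sup>2 - (t - t0)\<^sup>2) ^ n * \<psi> t"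
      proof cases
        case 1
        then have "\<rho> \<le> h\<^sup>2 - (t - t0)\<^sup>2" using sq[of "\<eta>/2"] \<eta> by (simp add: \<rho>_def)
        then have "\<rho> ^ n * c \<le> (h\<^sup>2 - (t - t0)\<^sup>2) ^ n * \<psi> t"
          using c \<theta> 1 \<eta> by (intro mult_mono power_mono) auto
        moreover have "0 \<le> M * \<theta> ^ n" using M \<theta> by simp
        moreover have "0 \<le> \<rho> ^ n * c" using c(1) \<theta> by simp
        ultimately show ?thesis by (simp add: mult.commute)
      next
        case 2
        then have "0 \<le> (h\<^sup>2 - (t - t0)\<^sup>2) ^ n * \<psi> t" using c(1) c(2)[of t] w0 by simp
        moreover have "0 \<le> M * \<theta> ^ n" using M \<theta> by simp
        moreover have "t \<notin> {t0 - \<eta>/2..t0 + \<eta>/2}"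
          using 2 unfolding atLeastAtMost_iff by linarith
        ultimately show ?thesis by auto
      next
        case 3
        then have "h\<^sup>2 - (t - t0)\<^sup>2 \<le> \<theta>" using sq[of \<eta>] \<eta> by (simp add: \<theta>_def)
        then have "(h\<^sup>2 - (t - t0)\<^sup>2) ^ n * \<bar>\<psi> t\<bar> \<le> \<theta> ^ n * M"
          using M(2)[OF t] w0 \<theta> by (intro mult_mono power_mono) auto
        moreover have "- ((h\<^sup>2 - (t - t0)\<^sup>2) ^ n * \<psi> t) \<le> (h\<^sup>2 - (t - t0)\<^sup>2) ^ n * \<bar>\<psi> t\<bar>"
          using w0 by (metis abs_le_D2 abs_mult abs_of_nonneg order_refl zero_le_power)
        moreover have "t \<notin> {t0 - \<eta>/2..t0 + \<eta>/2}"
          using 3 \<eta> unfolding atLeastAtMost_iff by linarith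
        ultimately show ?thesis by (auto simp: mult.commute)
      qed
    qed
    then have "c * \<rho> ^ n * \<eta> \<le> 2 * h * M * \<theta> ^ n + C * (D ^ n / fact n)"
      using le[of n] by (simp add: algebra_simps)
    also have "\<dots> = (2 * h * M * (\<theta> / \<rho>) ^ n + C * (inverse (fact n) * (D / \<rho>) ^ n)) * \<rho> ^ n"
      using \<theta> by (simp add: power_divide field_simps)
    finally have "(c * \<eta>) * \<rho> ^ n \<le> (2 * h * M * (\<theta> / \<rho>) ^ n + C * (inverse (fact n) * (D / \<rho>) ^ n)) * \<rho> ^ n"
      by (simp add: mult_ac)
    then show ?thesis using \<theta> by simp
  qed
  \<comment> \<open>The first summand is geometric with ratio \<open>\<theta> / \<rho> < 1\<close>;
    the second is a multiple of the general term of an exponential series.\<close>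
  have "(\<lambda>n. 2 * h * M * (\<theta> / \<rho>) ^ n + C * (inverse (fact n) * (D / \<rho>) ^ n)) \<longlonglongrightarrow> 2 * h * M * 0 + C * 0"
    by (intro tendsto_intros LIMSEQ_realpow_zero summable_LIMSEQ_zero[OF summable_exp]) (use \<theta> in auto)
  then have "c * \<eta> \<le> 2 * h * M * 0 + C * 0"
    by (rule LIMSEQ_le_const) (use key in auto)
  then show False using c \<eta> by (simp add: mult_le_0_iff)
qed

text \<open>Moments in time against polynomial weights remove the time derivative by integration by
  parts, at the price of factors that grow with the exponents. Each such step also solves the
  equation in \<open>x\<close> once and gains two powers of \<open>x - a\<close>. After
  \<open>n\<close> steps the gained \<open>fact (2 * n)\<close> cancels the collected factors up to
  \<open>1 / fact n\<close>, which is what the moment criterion requires.\<close>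

lemma sideways_uniqueness:
  fixes z :: "real \<Rightarrow> real \<Rightarrow> 'b::euclidean_space"
    and prod :: "'a::real_normed_vector \<Rightarrow> 'b \<Rightarrow> 'b" (infixl "\<odot>" 70)
  assumes prod: "bounded_bilinear (\<odot>)"
    and Q: "continuous_on {a..b} Q"
    and z: "continuous_on ({\<alpha>..\<beta>} \<times> {a..b}) (\<lambda>(t, x). z t x)"
    and zt: "continuous_on ({\<alpha>..\<beta>} \<times> {a..b}) (\<lambda>(t, x). zt t x)"
    and Dt: "\<And>t x. t \<in> {\<alpha>..\<beta>} \<Longrightarrow> x \<in> {a..b} \<Longrightarrow>
      ((\<lambda>t. z t x) has_vector_derivative zt t x) (at t within {\<alpha>..\<beta>})"
    and Dx: "\<And>t x. t \<in> {\<alpha>..\<beta>} \<Longrightarrow> x \<in> {a..b} \<Longrightarrow>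
      (z t has_vector_derivative zx t x) (at x within {a..b})"
    and Dxx: "\<And>t x. t \<in> {\<alpha>..\<beta>} \<Longrightarrow> x \<in> {a..b} \<Longrightarrow>
      (zx t has_vector_derivative Q x \<odot> z t x + m \<odot> zt t x) (at x within {a..b})"
    and zero: "\<And>t. t \<in> {\<alpha>..\<beta>} \<Longrightarrow> z t a = 0" "\<And>t. t \<in> {\<alpha>..\<beta>} \<Longrightarrow> zx t a = 0"
    and \<alpha>\<beta>: "\<alpha> < \<beta>" and t: "t \<in> {\<alpha>..\<beta>}" and x: "x \<in> {a..b}"
  shows "z t x = 0"
proof -
  interpret bounded_bilinear "(\<odot>)" by (rule prod)
  have interior: "z t0 x = 0" if t0: "\<alpha> < t0" "t0 < \<beta>" for t0
  proof -
    \<comment> \<open>A window symmetric about \<open>t0\<close> makes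
      \<open>(t - A) * (B - t)\<close> equal to \<open>h\<^sup>2 - (t - t0)\<^sup>2\<close>, the
      weight of the moment criterion.\<close>
    define h where "h = min (t0 - \<alpha>) (\<beta> - t0)"
    define A B where "A = t0 - h" and "B = t0 + h"
    have h: "0 < h" "A \<le> B" "{A..B} \<subseteq> {\<alpha>..\<beta>}" using t0 by (auto simp: h_def A_def B_def)
    have sub: "{A..B} \<times> {a..b} \<subseteq> {\<alpha>..\<beta>} \<times> {a..b}" using h by auto
    note zc = continuous_on_subset[OF z sub] and ztc = continuous_on_subset[OF zt sub]
    \<comment> \<open>Two independent exponents are kept because differentiation lowers one of them
      at a time; powers of the symmetric weight alone are not closed under it.\<close>
    define \<phi> :: "nat \<Rightarrow> nat \<Rightarrow> real \<Rightarrow> real" where "\<phi> i j t = (t - A) ^ i * (B - t) ^ j" for i j t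
    define Z where "Z i j y = integral {A..B} (\<lambda>t. \<phi> i j t *\<^sub>R z t y)" for i j y
    have \<phi>_cont [continuous_intros]: "continuous_on S (\<phi> i j)" for S i j
      unfolding \<phi>_def by (intro continuous_intros)
    have Z_cont: "continuous_on {a..b} (Z i j)" for i j
    proof -
      have "continuous_on ({a..b} \<times> cbox A B) (\<lambda>(y, t). \<phi> i j t *\<^sub>R z t y)"
        unfolding case_prod_unfold
        by (intro continuous_intros continuous_on_compose2[OF \<phi>_cont[of UNIV]]
            continuous_on_compose2[OF zc[unfolded case_prod_unfold],
              where f = "\<lambda>y. (snd y, fst y)", simplified])
          (auto intro!: continuous_intros)
      from integral_continuous_on_param[OF this] show ?thesis by (simp add: Z_def[abs_def])
    qed
    have zy: "continuous_on {A..B} (\<lambda>t. z t y)" "continuous_on {A..B} (\<lambda>t. zt t y)" if "y \<in> {a..b}" for y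
      using continuous_on_slice(1)[OF zc that] continuous_on_slice(1)[OF ztc that] by auto
    \<comment> \<open>Both exponents are positive, so the weight vanishes at \<open>A\<close> and
      \<open>B\<close> and no boundary terms occur.\<close>
    have by_parts: "((\<lambda>t. \<phi> (Suc i) (Suc j) t *\<^sub>R zt t y) has_integral
        of_nat (Suc j) *\<^sub>R Z (Suc i) j y - of_nat (Suc i) *\<^sub>R Z i (Suc j) y) {A..B}"
      if y: "y \<in> {a..b}" for i j y
    proof -
      have "((\<lambda>t. \<phi> (Suc i) (Suc j) t *\<^sub>R z t y) has_vector_derivative
          \<phi> (Suc i) (Suc j) t *\<^sub>R zt t y +
          (of_nat (Suc i) * \<phi> i (Suc j) t - of_nat (Suc j) * \<phi> (Suc i) j t) *\<^sub>R z t y) (at t within {A..B})"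
        if "t \<in> {A..B}" for t
      proof (rule has_vector_derivative_scaleR)
        show "((\<lambda>t. z t y) has_vector_derivative zt t y) (at t within {A..B})"
          by (rule has_vector_derivative_within_subset[OF Dt[OF _ y] h(3)]) (use that h in auto)
        have "(\<phi> (Suc i) (Suc j) has_real_derivative
            (of_nat (Suc i) * (t - A) ^ i * 1) * (B - t) ^ Suc j +
            (of_nat (Suc j) * (B - t) ^ j * (-1)) * (t - A) ^ Suc i) (at t within {A..B})"
          unfolding \<phi>_def[abs_def]
          by (intro DERIV_mult DERIV_power_Suc[THEN DERIV_cong]) (auto intro!: derivative_eq_intros simp del: power_Suc of_nat_Suc)
        then show "(\<phi> (Suc i) (Suc j) has_real_derivative
            of_nat (Suc i) * \<phi> i (Suc j) t - of_nat (Suc j) * \<phi> (Suc i) j t) (at t within {A..B})"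
          by (rule DERIV_cong) (simp add: \<phi>_def algebra_simps)
      qed
      from fundamental_theorem_of_calculus[OF h(2) this]
      have 1: "((\<lambda>t. \<phi> (Suc i) (Suc j) t *\<^sub>R zt t y +
          (of_nat (Suc i) * \<phi> i (Suc j) t - of_nat (Suc j) * \<phi> (Suc i) j t) *\<^sub>R z t y) has_integral 0) {A..B}"
        by (simp add: \<phi>_def)
      have 2: "((\<lambda>t. \<phi> i j t *\<^sub>R z t y) has_integral Z i j y) {A..B}" for i j
        unfolding Z_def by (intro integrable_integral integrable_continuous_real continuous_intros zy y)
      have "((\<lambda>t. of_nat (Suc i) *\<^sub>R (\<phi> i (Suc j) t *\<^sub>R z t y) - of_nat (Suc j) *\<^sub>R (\<phi> (Suc i) j t *\<^sub>R z t y))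
          has_integral of_nat (Suc i) *\<^sub>R Z i (Suc j) y - of_nat (Suc j) *\<^sub>R Z (Suc i) j y) {A..B}"
        by (intro has_integral_diff has_integral_cmul 2)
      from has_integral_diff[OF 1 this] show ?thesis
        by (simp add: algebra_simps)
    qed
    \<comment> \<open>Taylor's formula in \<open>x\<close> is averaged over time, the integrals are
      exchanged, and the time derivative is removed by parts.\<close>
    have eq: "Z (Suc i) (Suc j) x = integral {a..x} (\<lambda>y. (x - y) *\<^sub>R (Q y \<odot> Z (Suc i) (Suc j) y +
        m \<odot> (of_nat (Suc j) *\<^sub>R Z (Suc i) j y - of_nat (Suc i) *\<^sub>R Z i (Suc j) y)))"
      if x: "x \<in> {a..b}" for i j x
    proof -
      let ?f = "\<phi> (Suc i) (Suc j)"
      have "Z (Suc i) (Suc j) x = integral {A..B} (\<lambda>t. integral {a..x} (\<lambda>y. (x - y) *\<^sub>R ?f t *\<^sub>R (Q y \<odot> z t y + m \<odot> zt t y)))"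
        unfolding Z_def
      proof (rule integral_cong)
        fix t assume "t \<in> {A..B}"
        then have t: "t \<in> {\<alpha>..\<beta>}" using h by auto
        have "((\<lambda>y. (x - y) *\<^sub>R (Q y \<odot> z t y + m \<odot> zt t y)) has_integral z t x) {a..x}"
          by (rule has_integral_taylor2[OF Dx[OF t] Dxx[OF t] zero(1)[OF t] zero(2)[OF t] x])
        from has_integral_cmul[OF this, of "?f t"]
        show "?f t *\<^sub>R z t x = integral {a..x} (\<lambda>y. (x - y) *\<^sub>R ?f t *\<^sub>R (Q y \<odot> z t y + m \<odot> zt t y))"
          by (simp add: integral_unique mult.commute)
      qed
      also have "\<dots> = integral {a..x} (\<lambda>y. integral {A..B} (\<lambda>t. (x - y) *\<^sub>R ?f t *\<^sub>R (Q y \<odot> z t y + m \<odot> zt t y)))"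
      proof -
        have s: "{A..B} \<times> {a..x} \<subseteq> {A..B} \<times> {a..b}" using x by auto
        have "continuous_on ({A..B} \<times> {a..x}) (\<lambda>(t, y). (x - y) *\<^sub>R ?f t *\<^sub>R (Q y \<odot> z t y + m \<odot> zt t y))"
          using continuous_on_subset[OF zc s] continuous_on_subset[OF ztc s] x
          unfolding case_prod_unfold
          by (intro continuous_intros continuous_on continuous_on_compose2[OF \<phi>_cont[of UNIV]]
              continuous_on_compose2[OF Q]) (auto intro!: continuous_intros)
        then show ?thesis
          using integral_swap_continuous[of A a B x "\<lambda>t y. (x - y) *\<^sub>R ?f t *\<^sub>R (Q y \<odot> z t y + m \<odot> zt t y)"]
          by (simp add: cbox_Pair_eq)
      qed
      also have "\<dots> = integral {a..x} (\<lambda>y. (x - y) *\<^sub>R (Q y \<odot> Z (Suc i) (Suc j) y +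
        m \<odot> (of_nat (Suc j) *\<^sub>R Z (Suc i) j y - of_nat (Suc i) *\<^sub>R Z i (Suc j) y)))"
      proof (intro integral_cong integral_unique)
        fix y assume "y \<in> {a..x}"
        then have y: "y \<in> {a..b}" using x by auto
        have "((\<lambda>t. ?f t *\<^sub>R z t y) has_integral Z (Suc i) (Suc j) y) {A..B}"
          unfolding Z_def by (intro integrable_integral integrable_continuous_real continuous_intros zy y)
        from has_integral_add[OF has_integral_linear[OF this bounded_linear_right[of "Q y"]]
            has_integral_linear[OF by_parts[OF y] bounded_linear_right[of m]]]
        have "((\<lambda>t. ?f t *\<^sub>R (Q y \<odot> z t y + m \<odot> zt t y)) has_integral (Q y \<odot> Z (Suc i) (Suc j) y +
            m \<odot> (of_nat (Suc j) *\<^sub>R Z (Suc i) j y - of_nat (Suc i) *\<^sub>R Z i (Suc j) y))) {A..B}"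
          by (simp add: o_def scaleR_right scaleR_add_right del: of_nat_Suc)
        then show "((\<lambda>t. (x - y) *\<^sub>R ?f t *\<^sub>R (Q y \<odot> z t y + m \<odot> zt t y)) has_integral (x - y) *\<^sub>R (Q y \<odot> Z (Suc i) (Suc j) y +
            m \<odot> (of_nat (Suc j) *\<^sub>R Z (Suc i) j y - of_nat (Suc i) *\<^sub>R Z i (Suc j) y))) {A..B}"
          by (rule has_integral_cmul)
      qed
      finally show ?thesis .
    qed
    have "compact (Q ` {a..b})" "compact ((\<lambda>(t, x). z t x) ` ({A..B} \<times> {a..b}))"
      using compact_continuous_image[OF Q] compact_continuous_image[OF zc] by (auto intro: compact_Times)
    from this[THEN compact_imp_bounded] obtain q0 M
      where q0: "0 < q0" "\<And>y. y \<in> {a..b} \<Longrightarrow> norm (Q y) \<le> q0"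
        and M: "0 < M" "\<And>t y. t \<in> {A..B} \<Longrightarrow> y \<in> {a..b} \<Longrightarrow> norm (z t y) \<le> M"
      unfolding bounded_pos by fastforce
    obtain K where K: "0 < K" "\<And>X Y. norm (X \<odot> Y) \<le> norm X * norm Y * K"
      using pos_bounded by blast
    define q where "q = q0 * K"
    define \<mu> where "\<mu> = norm m * K"
    define H where "H = B - A"
    define E where "E = 2 * exp ((2 * q + 1) * (b - a)) * \<mu>"
    have nn: "0 \<le> q" "0 \<le> \<mu>" "0 \<le> H" "0 \<le> E" using q0 K h by (auto simp: q_def \<mu>_def H_def E_def)
    \<comment> \<open>The surplus exponents \<open>i\<close> and \<open>j\<close> must be arbitrary
      in the induction: a step leads from \<open>(Suc n, i, j)\<close> to
      \<open>(n, Suc i, j)\<close> and \<open>(n, i, Suc j)\<close>. \<open>H\<close> bounds both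
      linear factors of the weight, \<open>E\<close> is the constant of one Gronwall step, and the
      quotient of factorials collects the factors from integration by parts.\<close>
    have bound: "norm (Z (n + i) (n + j) y) \<le>
        M * H * (H ^ (n + i + j) * E ^ n * (fact (2 * n + i + j) / fact (n + i + j))) * ((y - a) ^ (2 * n) / fact (2 * n))"
      if "y \<in> {a..b}" for n i j y
      using that
    proof (induction n arbitrary: i j y)
      case 0
      have "norm (Z i j y) \<le> (H ^ i * H ^ j * M) * (B - A)"
        unfolding Z_def
      proof (rule integral_bound[OF h(2)])
        show "continuous_on {A..B} (\<lambda>t. \<phi> i j t *\<^sub>R z t y)"
          using 0 by (intro continuous_intros zy)
        show "norm (\<phi> i j t *\<^sub>R z t y) \<le> H ^ i * H ^ j * M" if "t \<in> {A..B}" for t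
          unfolding \<phi>_def using that 0 M
          by (auto simp: H_def abs_mult power_abs intro!: mult_mono power_mono)
      qed
      then show ?case by (simp add: H_def power_add mult_ac)
    next
      case (Suc n)
      define C where "C = M * H * (H ^ (n + i + j + 1) * E ^ n * (fact (2 * n + i + j + 1) / fact (n + i + j + 1)))"
      \<comment> \<open>\<open>C\<close> is the common bound that the induction hypothesis gives for
        both lower moments. The two coefficients in front of them add up to the \<open>N\<close>
        defined next, which turns \<open>fact (2 * n + i + j + 1)\<close> into
        \<open>fact (2 * n + i + j + 2)\<close>.\<close>
      have C0: "0 \<le> C" using M nn by (simp add: C_def)
      define N where "N = real (2 * n + i + j + 2)"
      have "norm (Z (Suc (n + i)) (Suc (n + j)) y) \<le>
          2 * exp ((2 * q + 1) * (b - a)) * (\<mu> * N * C) * ((y - a) ^ (2 * n + 2) / fact (2 * n + 2))"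
      proof (rule double_integral_gronwall[OF Z_cont nn(1) _ _ Suc.prems])
        show "0 \<le> \<mu> * N * C" using nn C0 by (simp add: N_def)
        fix x assume x: "x \<in> {a..b}"
        let ?i = "n + i" and ?j = "n + j"
        let ?W = "\<lambda>y. of_nat (Suc ?j) *\<^sub>R Z (Suc ?i) ?j y - of_nat (Suc ?i) *\<^sub>R Z ?i (Suc ?j) y"
        have W: "norm (?W y) \<le> N * C * ((y - a) ^ (2 * n) / fact (2 * n))" if "y \<in> {a..b}" for y
        proof -
          have "norm (Z (n + Suc i) (n + j) y) \<le> C * ((y - a) ^ (2 * n) / fact (2 * n))"
            using Suc.IH[OF that, of "Suc i" j] by (simp add: C_def mult_ac)
          moreover have "norm (Z (n + i) (n + Suc j) y) \<le> C * ((y - a) ^ (2 * n) / fact (2 * n))"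
            using Suc.IH[OF that, of i "Suc j"] by (simp add: C_def mult_ac)
          ultimately have "norm (?W y) \<le> of_nat (Suc ?j) * (C * ((y - a) ^ (2 * n) / fact (2 * n))) +
              of_nat (Suc ?i) * (C * ((y - a) ^ (2 * n) / fact (2 * n)))"
            by (intro order_trans[OF norm_triangle_ineq4] add_mono)
              (simp_all only: norm_scaleR abs_of_nat mult_left_mono of_nat_0_le_iff add_Suc_right)
          also have "of_nat (Suc ?j) * D + of_nat (Suc ?i) * D = N * D" for D
            by (simp add: N_def algebra_simps)
          finally show ?thesis by (simp add: mult.assoc)
        qed
        have Wc: "continuous_on {a..x} ?W"
          using x by (intro continuous_intros continuous_on_subset[OF Z_cont]) auto
        have Zc: "continuous_on {a..x} (Z (Suc ?i) (Suc ?j))" "continuous_on {a..x} Q"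
          using continuous_on_subset[OF Z_cont] continuous_on_subset[OF Q] x by auto
        show "norm (Z (Suc ?i) (Suc ?j) x) \<le> integral {a..x} (\<lambda>y. (x - y) *
            (q * norm (Z (Suc ?i) (Suc ?j) y) + \<mu> * N * C * ((y - a) ^ (2 * n) / fact (2 * n))))"
          unfolding eq[OF x, of ?i ?j]
        proof (rule integral_norm_bound_integral)
          show "(\<lambda>y. (x - y) *\<^sub>R (Q y \<odot> Z (Suc ?i) (Suc ?j) y + m \<odot> ?W y)) integrable_on {a..x}"
            by (intro integrable_continuous_real continuous_intros continuous_on Zc Wc)
          show "(\<lambda>y. (x - y) * (q * norm (Z (Suc ?i) (Suc ?j) y) +
              \<mu> * N * C * ((y - a) ^ (2 * n) / fact (2 * n)))) integrable_on {a..x}"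
            by (intro integrable_continuous_real continuous_intros Zc) auto
          fix y assume "y \<in> {a..x}"
          then have y: "y \<in> {a..b}" "y \<le> x" using x by auto
          have "norm (Q y \<odot> Z (Suc ?i) (Suc ?j) y) \<le> q * norm (Z (Suc ?i) (Suc ?j) y)"
            using order_trans[OF K(2) mult_right_mono[OF mult_right_mono[OF q0(2)[OF y(1)]]]] K(1)
            by (simp add: q_def mult_ac)
          moreover have "norm (m \<odot> ?W y) \<le> \<mu> * (N * C * ((y - a) ^ (2 * n) / fact (2 * n)))"
          proof -
            have "norm m * norm (?W y) * K \<le> norm m * (N * C * ((y - a) ^ (2 * n) / fact (2 * n))) * K"
              using K(1) by (intro mult_left_mono mult_right_mono W[OF y(1)]) auto
            from order_trans[OF K(2) this] show ?thesis by (simp only: \<mu>_def mult_ac)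
          qed
          ultimately have "norm (Q y \<odot> Z (Suc ?i) (Suc ?j) y + m \<odot> ?W y) \<le> q * norm (Z (Suc ?i) (Suc ?j) y) +
              \<mu> * N * C * ((y - a) ^ (2 * n) / fact (2 * n))"
            by (intro order_trans[OF norm_triangle_ineq]) (simp add: mult.assoc)
          then show "norm ((x - y) *\<^sub>R (Q y \<odot> Z (Suc ?i) (Suc ?j) y + m \<odot> ?W y)) \<le>
              (x - y) * (q * norm (Z (Suc ?i) (Suc ?j) y) + \<mu> * N * C * ((y - a) ^ (2 * n) / fact (2 * n)))"
            using y by (simp add: mult_left_mono del: of_nat_Suc)
        qed
      qed
      also have "\<dots> = M * H * (H ^ (Suc n + i + j) * E ^ Suc n * (fact (2 * Suc n + i + j) / fact (Suc n + i + j))) *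
          ((y - a) ^ (2 * Suc n) / fact (2 * Suc n))"
        by (simp add: C_def E_def N_def field_simps)
      finally show ?case by simp
    qed
    \<comment> \<open>Pairing with the fixed vector \<open>z t0 x\<close> reduces to a scalar
      function whose value at \<open>t0\<close> is the squared norm.\<close>
    have "inner (z t0 x) (z t0 x) \<le> 0"
    proof (rule landau_kernel_moments[where \<psi> = "\<lambda>t. inner (z t0 x) (z t x)"])
      show "0 < h" by (rule h)
      show "continuous_on {t0-h..t0+h} (\<lambda>t. inner (z t0 x) (z t x))"
        using zy(1)[OF x] by (intro continuous_intros) (simp add: A_def B_def)
      fix n
      have "((\<lambda>t. \<phi> n n t *\<^sub>R z t x) has_integral Z n n x) {A..B}"
        unfolding Z_def by (intro integrable_integral integrable_continuous_real continuous_intros zy x)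
      from has_integral_linear[OF this bounded_linear_inner_right[of "z t0 x"]]
      have "((\<lambda>t. (h\<^sup>2 - (t - t0)\<^sup>2) ^ n * inner (z t0 x) (z t x)) has_integral inner (z t0 x) (Z n n x)) {t0-h..t0+h}"
        by (simp add: o_def \<phi>_def A_def B_def flip: power_mult_distrib)
          (simp add: power2_eq_square algebra_simps)
      then have "integral {t0-h..t0+h} (\<lambda>t. (h\<^sup>2 - (t - t0)\<^sup>2) ^ n * inner (z t0 x) (z t x)) = inner (z t0 x) (Z n n x)"
        by (rule integral_unique)
      also have "\<dots> \<le> norm (z t0 x) * norm (Z n n x)"
        by (rule norm_cauchy_schwarz)
      also have "\<dots> \<le> norm (z t0 x) * (M * H * (H ^ n * E ^ n * (fact (2 * n) / fact n)) * ((x - a) ^ (2 * n) / fact (2 * n)))"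
        using bound[OF x, of n 0 0] by (intro mult_left_mono) auto
      also have "\<dots> = norm (z t0 x) * (M * H) * ((H * E * (x - a)\<^sup>2) ^ n / fact n)"
        by (simp add: power_mult_distrib field_simps flip: power_mult)
      finally show "integral {t0-h..t0+h} (\<lambda>t. (h\<^sup>2 - (t - t0)\<^sup>2) ^ n * inner (z t0 x) (z t x)) \<le>
        norm (z t0 x) * (M * H) * ((H * E * (x - a)\<^sup>2) ^ n / fact n)" .
    qed
    then show ?thesis by (metis inner_eq_zero_iff inner_ge_zero order_antisym)
  qed
  \<comment> \<open>No symmetric window of positive width exists at the two end times; they follow
    by continuity.\<close>
  have "continuous_on {\<alpha>..\<beta>} (\<lambda>t. z t x)"
    using continuous_on_slice(1)[OF z x] by simp
  moreover have "closure {\<alpha><..<\<beta>} = {\<alpha>..\<beta>}" using \<alpha>\<beta> by simp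
  ultimately show ?thesis
    using continuous_constant_on_closure[of "{\<alpha><..<\<beta>}" "\<lambda>t. z t x" 0 t] interior t by auto
qed

subsection \<open>Extending the interval on which the potentials agree\<close>

lemma bounded_bilinear_matrix_mult:
  "bounded_bilinear ((**) :: complex^'n^'m \<Rightarrow> complex^'p^'n \<Rightarrow> complex^'p^'m)"
  unfolding bilinear_conv_bounded_bilinear[symmetric] bilinear_def
  by (auto intro!: linearI simp: matrix_add_ldistrib vec_eq_iff matrix_matrix_mult_def
      scaleR_sum_right sum.distrib distrib_left distrib_right)

text \<open>On the compact product of \<open>{a..b}\<close> with the unit sphere the continuous
  function \<open>norm (X ** U x)\<close> attains its minimum, which is positive because the matrix
  \<open>U x\<close> at the minimum is invertible. Homogeneity extends the bound to all
  \<open>X\<close>.\<close>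

lemma norm_matrix_mult_lower_bound:
  fixes U :: "real \<Rightarrow> complex^'n^'n"
  assumes U: "continuous_on {a..b} U" and det: "\<And>x. x \<in> {a..b} \<Longrightarrow> det (U x) \<noteq> 0"
  shows "\<exists>\<mu>>0. \<forall>x\<in>{a..b}. \<forall>X :: complex^'n^'n. \<mu> * norm X \<le> norm (X ** U x)"
proof (cases "a \<le> b")
  case True
  interpret bounded_bilinear "(**) :: complex^'n^'n \<Rightarrow> complex^'n^'n \<Rightarrow> complex^'n^'n"
    by (rule bounded_bilinear_matrix_mult)
  let ?S = "sphere 0 1 :: (complex^'n^'n) set"
  have "continuous_on ({a..b} \<times> ?S) (\<lambda>z. norm (snd z ** U (fst z)))"
    by (intro continuous_intros continuous_on continuous_on_compose2[OF U]) auto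
  moreover have "compact ({a..b} \<times> ?S)" by (intro compact_Times) auto
  moreover have "{a..b} \<times> ?S \<noteq> {}" using True by simp
  ultimately obtain x0 X0 where 0: "x0 \<in> {a..b}" "X0 \<in> ?S"
    and inf: "\<And>x X. x \<in> {a..b} \<Longrightarrow> X \<in> ?S \<Longrightarrow> norm (X0 ** U x0) \<le> norm (X ** U x)"
    using continuous_attains_inf[of "{a..b} \<times> ?S" "\<lambda>z. norm (snd z ** U (fst z))"] by force
  obtain V where V: "U x0 ** V = mat 1"
    using det[OF 0(1)] by (auto simp: invertible_det_nz[symmetric] invertible_def)
  have pos: "0 < norm (X0 ** U x0)"
  proof (rule ccontr)
    assume "\<not> ?thesis"
    then have "X0 ** U x0 = 0" by simp
    then have "X0 ** (U x0 ** V) = 0" by (simp add: matrix_mul_assoc zero_left)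
    then show False using V 0(2) by simp
  qed
  have "norm (X0 ** U x0) * norm X \<le> norm (X ** U x)" if x: "x \<in> {a..b}" for x and X :: "complex^'n^'n"
  proof (cases "X = 0")
    case False
    have "norm (X0 ** U x0) \<le> norm ((X /\<^sub>R norm X) ** U x)"
      by (rule inf[OF x]) (use False in simp)
    then show ?thesis using False by (simp add: scaleR_left field_simps)
  qed (simp add: zero_left)
  then show ?thesis using pos by blast
qed (auto intro: exI[of _ 1])

text \<open>The derivatives are explicit functions, and the equation is expressed as the derivative
  of \<open>Ux\<close>, up to the edges of the rectangle. Multiplication by \<open>\<sigma>\<close>
  is written with \<open>mat \<sigma>\<close>, so that both terms use the same bilinear
  product.\<close>

definition matrix_solution ::
  "real \<Rightarrow> real \<Rightarrow> complex \<Rightarrow> (real \<Rightarrow> complex^'n^'n) \<Rightarrow> (real \<Rightarrow> real \<Rightarrow> complex^'n^'n) \<Rightarrow>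
    (real \<Rightarrow> real \<Rightarrow> complex^'n^'n) \<Rightarrow> (real \<Rightarrow> real \<Rightarrow> complex^'n^'n) \<Rightarrow> bool" where
  "matrix_solution T l \<sigma> P U Ut Ux \<longleftrightarrow>
     continuous_on ({0..T} \<times> {0..l}) (\<lambda>(t, x). U t x) \<and>
     continuous_on ({0..T} \<times> {0..l}) (\<lambda>(t, x). Ut t x) \<and>
     (\<forall>t\<in>{0..T}. \<forall>x\<in>{0..l}.
        ((\<lambda>t. U t x) has_vector_derivative Ut t x) (at t within {0..T}) \<and>
        (U t has_vector_derivative Ux t x) (at x within {0..l}) \<and>
        (Ux t has_vector_derivative P x ** U t x + mat \<sigma> ** Ut t x) (at x within {0..l}))"

text \<open>The kernel multiplies from the left, so \<open>\<sigma>\<close> has to be moved past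
  it.\<close>

lemma mat_commute: "mat (\<sigma>::'a::comm_semiring_1) ** X = X ** mat \<sigma>"
  by (auto simp: vec_eq_iff matrix_matrix_mult_def mat_def if_distrib if_distribR sum.delta
      mult.commute cong: if_cong)

text \<open>The smaller interval may touch \<open>x\<close> only from one side: a one-sided
  derivative already determines \<open>D\<close>.\<close>

lemma vector_derivative_zero_on:
  assumes f: "(f has_vector_derivative D) (at x within {a..b})"
    and zero: "\<And>y. y \<in> {c..d} \<Longrightarrow> f y = 0" and sub: "{c..d} \<subseteq> {a..b}" and x: "x \<in> {c..d}" and cd: "c < d"
  shows "D = 0"
proof (rule vector_derivative_unique_within)
  show "at x within {c..d} \<noteq> bot"
    using x cd by (simp add: trivial_limit_within islimpt_Icc)
  show "(f has_vector_derivative D) (at x within {c..d})"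
    by (rule has_vector_derivative_within_subset[OF f sub])
  show "(f has_vector_derivative 0) (at x within {c..d})"
    by (rule has_vector_derivative_transform[OF x, of _ "\<lambda>_. 0"]) (use zero in auto)
qed

text \<open>Where the potentials coincide, \<open>V - U\<close> solves the homogeneous equation with
  zero Cauchy data at \<open>x = 0\<close>.\<close>

lemma matrix_solutions_agree:
  assumes U: "matrix_solution T l \<sigma> P U Ut Ux" and V: "matrix_solution T l \<sigma> Q V Vt Vx"
    and P: "continuous_on {0..l} P"
    and eq: "\<And>x. x \<in> {0..c} \<Longrightarrow> P x = Q x" and c: "0 \<le> c" "c \<le> l" and T: "0 < T"
    and bc: "\<And>t. t \<in> {0..T} \<Longrightarrow> U t 0 = V t 0" "\<And>t. t \<in> {0..T} \<Longrightarrow> Ux t 0 = Vx t 0"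
    and t: "t \<in> {0..T}" and x: "x \<in> {0..c}"
  shows "V t x = U t x"
proof -
  interpret bounded_bilinear "(**) :: complex^'n^'n \<Rightarrow> complex^'n^'n \<Rightarrow> complex^'n^'n"
    by (rule bounded_bilinear_matrix_mult)
  have sub: "{0..c} \<subseteq> {0..l}" "{0..T} \<times> {0..c} \<subseteq> {0..T} \<times> {0..l}" using c by auto
  note U = U[unfolded matrix_solution_def] and V = V[unfolded matrix_solution_def]
  have "V t x - U t x = 0"
  proof (rule sideways_uniqueness[OF bounded_bilinear_axioms, where a = 0 and b = c and Q = P and m = "mat \<sigma>"
        and zt = "\<lambda>t x. Vt t x - Ut t x" and zx = "\<lambda>t x. Vx t x - Ux t x"])
    show "continuous_on ({0..T} \<times> {0..c}) (\<lambda>(t, x). V t x - U t x)"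
      "continuous_on ({0..T} \<times> {0..c}) (\<lambda>(t, x). Vt t x - Ut t x)"
      using U V unfolding case_prod_unfold
      by (auto intro!: continuous_on_diff intro: continuous_on_subset[OF _ sub(2)])
    fix t x assume tx: "t \<in> {0..T}" "x \<in> {0..c}"
    then have x: "x \<in> {0..l}" using sub by auto
    show "((\<lambda>t. V t x - U t x) has_vector_derivative Vt t x - Ut t x) (at t within {0..T})"
      using U V tx x by (intro has_vector_derivative_diff) auto
    show "((\<lambda>x. V t x - U t x) has_vector_derivative Vx t x - Ux t x) (at x within {0..c})"
      by (rule has_vector_derivative_within_subset[OF _ sub(1)])
        (use U V tx x in \<open>auto intro!: has_vector_derivative_diff\<close>)
    have "((\<lambda>x. Vx t x - Ux t x) has_vector_derivative
        (Q x ** V t x + mat \<sigma> ** Vt t x) - (P x ** U t x + mat \<sigma> ** Ut t x)) (at x within {0..c})"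
      by (rule has_vector_derivative_within_subset[OF _ sub(1)])
        (use U V tx x in \<open>auto intro!: has_vector_derivative_diff\<close>)
    then show "((\<lambda>x. Vx t x - Ux t x) has_vector_derivative
        P x ** (V t x - U t x) + mat \<sigma> ** (Vt t x - Ut t x)) (at x within {0..c})"
      using eq[OF tx(2)] by (simp add: diff_right algebra_simps)
  qed (use T t x bc P sub in \<open>auto intro: continuous_on_subset\<close>)
  then show ?thesis by simp
qed

section \<open>Time dependence and existence of the transform, and the extension step\<close>

lemma continuous_norm_bound:
  fixes f :: "'a::topological_space \<Rightarrow> 'b::real_normed_vector"
  assumes "continuous_on S f" "compact S"
  obtains M where "0 < M" "\<And>x. x \<in> S \<Longrightarrow> norm (f x) \<le> M"
  using compact_imp_bounded[OF compact_continuous_image[OF assms]] that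
  unfolding bounded_pos by auto

context goursat_kernel
begin

lemma kernel_transform_time_dependent:
  assumes u: "continuous_on (I \<times> {c-d..c+d}) (\<lambda>(t, y). u t y)"
  shows "continuous_on (I \<times> {c..c+d}) (\<lambda>(t, x). integral {c..x} (\<lambda>s. k (s, x - s) \<odot> u t (2 * s - x)))"
  unfolding case_prod_unfold
proof (rule continuous_on_integral_upper[where f = "\<lambda>z s. k (s, snd z - s) \<odot> u (fst z) (2 * s - snd z)"])
  show "continuous_on {(z, y). z \<in> I \<times> {c..c+d} \<and> c \<le> y \<and> y \<le> snd z}
      (\<lambda>(z, s). k (s, snd z - s) \<odot> u (fst z) (2 * s - snd z))"
    unfolding case_prod_unfold
    by (intro continuous_on continuous_on_compose2[OF k_cont]
        continuous_on_compose2[OF u[unfolded case_prod_unfold],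
          where f = "\<lambda>z. (fst (fst z), 2 * snd z - snd (fst z))", simplified])
      (auto intro!: continuous_intros)
qed (auto intro!: continuous_intros)

text \<open>The kernel does not depend on time, so the transform commutes with the time
  derivative.\<close>

lemma kernel_transform_time_deriv:
  assumes u: "continuous_on (I \<times> {c-d..c+d}) (\<lambda>(t, y). u t y)"
    and ut: "continuous_on (I \<times> {c-d..c+d}) (\<lambda>(t, y). ut t y)"
    and D: "\<And>t y. t \<in> I \<Longrightarrow> y \<in> {c-d..c+d} \<Longrightarrow> ((\<lambda>t. u t y) has_vector_derivative ut t y) (at t within I)"
    and I: "convex I" "t \<in> I" and x: "x \<in> {c..c+d}"
  shows "((\<lambda>t. integral {c..x} (\<lambda>s. k (s, x - s) \<odot> u t (2 * s - x))) has_vector_derivative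
    integral {c..x} (\<lambda>s. k (s, x - s) \<odot> ut t (2 * s - x))) (at t within I)"
proof -
  have "((\<lambda>t. integral (cbox c x) (\<lambda>s. k (s, x - s) \<odot> u t (2 * s - x))) has_vector_derivative
    integral (cbox c x) (\<lambda>s. k (s, x - s) \<odot> ut t (2 * s - x))) (at t within I)"
  proof (rule leibniz_rule_vector_derivative)
    show "((\<lambda>t. k (s, x - s) \<odot> u t (2 * s - x)) has_vector_derivative k (s, x - s) \<odot> ut t (2 * s - x)) (at t within I)"
      if "t \<in> I" "s \<in> cbox c x" for t s
      by (rule bounded_linear.has_vector_derivative[OF bounded_linear_right D]) (use that x in auto)
    show "(\<lambda>s. k (s, x - s) \<odot> u t (2 * s - x)) integrable_on cbox c x" if "t \<in> I" for t
      using integrable_continuous_real[OF triangle_slice[OF k_cont continuous_on_slice(2)[OF u that] x]] by simp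
    show "continuous_on (I \<times> cbox c x) (\<lambda>(t, s). k (s, x - s) \<odot> ut t (2 * s - x))"
      unfolding case_prod_unfold
      by (intro continuous_on continuous_on_compose2[OF k_cont]
          continuous_on_compose2[OF ut[unfolded case_prod_unfold],
            where f = "\<lambda>z. (fst z, 2 * snd z - x)", simplified])
        (use x in \<open>auto intro!: continuous_intros\<close>)
  qed (use I in auto)
  then show ?thesis by simp
qed

end

text \<open>With \<open>x = s + r\<close> and \<open>y = s - r\<close> the operator
  \<open>K\<^sub>x\<^sub>x - K\<^sub>y\<^sub>y\<close> becomes the mixed derivative in
  \<open>s\<close> and \<open>r\<close>, with right-hand side linear in \<open>k\<close> and
  Lipschitz constant \<open>B\<close>. The problem is solved on a full rectangle, on which
  \<open>s + r\<close> reaches \<open>c + 2 * d\<close> and \<open>s - r\<close> reaches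
  \<open>c - d\<close>; hence the two bounds on \<open>d\<close>.\<close>

lemma goursat_kernel_exists:
  fixes P Q :: "real \<Rightarrow> complex^'n^'n"
  assumes P: "continuous_on {0..l} P" and Q: "continuous_on {0..l} Q"
    and c: "0 \<le> c - d" "c + 2 * d \<le> l" and d: "0 < d"
    and L: "\<And>x. x \<in> {0..l} \<Longrightarrow> norm (P x) \<le> L" "\<And>x. x \<in> {0..l} \<Longrightarrow> norm (Q x) \<le> L"
    and K: "0 < K" "\<And>(X :: complex^'n^'n) (Y :: complex^'n^'n). norm (X ** Y) \<le> norm X * norm Y * K"
    and B: "B = 2 * K * L" "B * d\<^sup>2 \<le> 1 / 2"
  obtains F k :: "real \<times> real \<Rightarrow> complex^'n^'n"
  where "goursat_kernel ((**) :: complex^'n^'n \<Rightarrow> complex^'n^'n \<Rightarrow> complex^'n^'n) c d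
      (\<lambda>x. integral {c..x} (\<lambda>y. Q y - P y)) (\<lambda>x. Q x - P x) F k"
    and "\<And>s r. s \<in> {c..c+d} \<Longrightarrow> r \<in> {0..d} \<Longrightarrow> F (s, r) = Q (s + r) ** k (s, r) - k (s, r) ** P (s - r)"
    and "\<And>z. z \<in> {c..c+d} \<times> {0..d} \<Longrightarrow> norm (F z) \<le> B * norm (k z)"
proof -
  interpret bounded_bilinear "(**) :: complex^'n^'n \<Rightarrow> complex^'n^'n \<Rightarrow> complex^'n^'n"
    by (rule bounded_bilinear_matrix_mult)
  let ?R = "{c..c+d} \<times> {0..d}"
  define \<Phi> :: "real \<times> real \<Rightarrow> complex^'n^'n \<Rightarrow> complex^'n^'n"
    where "\<Phi> z X = Q (fst z + snd z) ** X - X ** P (fst z - snd z)" for z X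
  define g where "g x = integral {c..x} (\<lambda>y. Q y - P y)" for x
  have QP: "continuous_on {c..c+d} (\<lambda>y. Q y - P y)"
    by (intro continuous_intros continuous_on_subset[OF Q] continuous_on_subset[OF P]) (use c d in auto)
  have g_deriv: "(g has_vector_derivative Q s - P s) (at s within {c..c+d})" if "s \<in> {c..c+d}" for s
    unfolding g_def[abs_def] by (rule integral_has_vector_derivative[OF QP that])
  have \<Phi>_cont: "continuous_on ?R (\<lambda>z. \<Phi> z (\<kappa> z))" if "continuous_on ?R \<kappa>" for \<kappa>
    unfolding \<Phi>_def
    by (intro continuous_intros continuous_on that continuous_on_compose2[OF Q] continuous_on_compose2[OF P])
      (use c d in auto)
  have \<Phi>_le: "norm (\<Phi> z X) \<le> B * norm X" if z: "z \<in> ?R" for z X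
  proof -
    have "norm (Q (fst z + snd z) ** X) \<le> L * norm X * K"
      by (rule order_trans[OF K(2)]) (use K(1) z c d in \<open>auto intro!: mult_right_mono L\<close>)
    moreover have "norm (X ** P (fst z - snd z)) \<le> norm X * L * K"
      by (rule order_trans[OF K(2)]) (use K(1) z c d in \<open>auto intro!: mult_right_mono mult_left_mono L\<close>)
    ultimately show ?thesis
      unfolding \<Phi>_def B(1) by (intro order_trans[OF norm_triangle_ineq4]) (simp add: mult_ac)
  qed
  have "norm (P 0) \<le> L" using L(1)[of 0] c d by simp
  then have L0: "0 \<le> L" using norm_ge_zero[of "P 0"] by linarith
  have "\<exists>\<kappa>. continuous_on ?R \<kappa> \<and> (\<forall>s\<in>{c..c+d}. \<forall>r\<in>{0..d}.
       \<kappa> (s, r) = g s + integral {c..s} (\<lambda>\<sigma>. integral {0..r} (\<lambda>\<rho>. \<Phi> (\<sigma>, \<rho>) (\<kappa> (\<sigma>, \<rho>)))))"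
  proof (rule goursat_solution_exists[where B = B])
    show "continuous_on {c..c+d} g"
      using g_deriv by (rule continuous_on_vector_derivative)
    show "norm (\<Phi> z X - \<Phi> z Y) \<le> B * norm (X - Y)" if "z \<in> ?R" for z X Y
    proof -
      have "\<Phi> z X - \<Phi> z Y = \<Phi> z (X - Y)"
        by (simp add: \<Phi>_def diff_left diff_right algebra_simps)
      then show ?thesis using \<Phi>_le[OF that] by simp
    qed
  qed (use d \<Phi>_cont B K L0 in auto)
  then obtain k where k: "continuous_on ?R k"
    "\<And>s r. s \<in> {c..c+d} \<Longrightarrow> r \<in> {0..d} \<Longrightarrow>
       k (s, r) = g s + integral {c..s} (\<lambda>\<sigma>. integral {0..r} (\<lambda>\<rho>. \<Phi> (\<sigma>, \<rho>) (k (\<sigma>, \<rho>))))"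
    by blast
  have "goursat_kernel ((**) :: complex^'n^'n \<Rightarrow> complex^'n^'n \<Rightarrow> complex^'n^'n) c d g (\<lambda>x. Q x - P x) (\<lambda>z. \<Phi> z (k z)) k"
    by (intro goursat_kernel.intro bounded_bilinear_matrix_mult goursat_kernel_axioms.intro)
      (use \<Phi>_cont[OF k(1)] k g_deriv in auto)
  then show ?thesis
    using \<Phi>_le by (intro that[of "\<lambda>z. \<Phi> z (k z)" k]) (auto simp: g_def[abs_def] \<Phi>_def)
qed

text \<open>Differentiating the transform \<open>v\<close> twice produces
  \<open>(Q x - P x) ** U t x\<close>, the source in the equation for \<open>V - U\<close>. Thus
  \<open>V - U - v\<close> solves a homogeneous equation with zero data at \<open>c\<close> and
  vanishes. At \<open>t0\<close> this leaves a Volterra equation for \<open>g\<close>, whose only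
  solution is zero.\<close>

lemma potentials_agree_further:
  assumes U: "matrix_solution T l \<sigma> P U Ut Ux" and V: "matrix_solution T l \<sigma> Q V Vt Vx"
    and P: "continuous_on {0..l} P" and Q: "continuous_on {0..l} Q"
    and eq: "\<And>x. x \<in> {0..c} \<Longrightarrow> P x = Q x" and c: "0 < c" "c < l" and T: "0 < T"
    and bc: "\<And>t. t \<in> {0..T} \<Longrightarrow> U t 0 = V t 0" "\<And>t. t \<in> {0..T} \<Longrightarrow> Ux t 0 = Vx t 0"
    and t0: "t0 \<in> {0..T}" and init: "\<And>x. x \<in> {0..l} \<Longrightarrow> U t0 x = V t0 x"
    and det: "\<And>x. x \<in> {0..l} \<Longrightarrow> det (U t0 x) \<noteq> 0"
  shows "\<exists>d>0. c + d \<le> l \<and> (\<forall>x\<in>{c..c+d}. P x = Q x)"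
proof -
  interpret M: bounded_bilinear "(**) :: complex^'a^'a \<Rightarrow> complex^'a^'a \<Rightarrow> complex^'a^'a"
    by (rule bounded_bilinear_matrix_mult)
  note U' = U[unfolded matrix_solution_def] and V' = V[unfolded matrix_solution_def]
  note agree = matrix_solutions_agree[OF U V P eq less_imp_le[OF c(1)] less_imp_le[OF c(2)] T bc]
  have UtD: "((\<lambda>t. U t x) has_vector_derivative Ut t x) (at t within {0..T})"
    and UxD: "(U t has_vector_derivative Ux t x) (at x within {0..l})"
    and UxxD: "(Ux t has_vector_derivative P x ** U t x + mat \<sigma> ** Ut t x) (at x within {0..l})"
    and VtD: "((\<lambda>t. V t x) has_vector_derivative Vt t x) (at t within {0..T})"
    and VxD: "(V t has_vector_derivative Vx t x) (at x within {0..l})"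
    and VxxD: "(Vx t has_vector_derivative Q x ** V t x + mat \<sigma> ** Vt t x) (at x within {0..l})"
    if "t \<in> {0..T}" "x \<in> {0..l}" for t x
    using U' V' that by auto
  have Uc: "continuous_on {0..l} (U t0)" and Uxc: "continuous_on {0..l} (Ux t0)"
    by (auto intro: continuous_on_vector_derivative[OF UxD[OF t0]] continuous_on_vector_derivative[OF UxxD[OF t0]])
  obtain L1 where L1: "0 < L1" "\<And>x. x \<in> {0..l} \<Longrightarrow> norm (P x) \<le> L1"
    using continuous_norm_bound[OF P] by auto
  obtain L2 where L2: "0 < L2" "\<And>x. x \<in> {0..l} \<Longrightarrow> norm (Q x) \<le> L2"
    using continuous_norm_bound[OF Q] by auto
  obtain M1 where M1: "0 < M1" "\<And>x. x \<in> {0..l} \<Longrightarrow> norm (U t0 x) \<le> M1"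
    using continuous_norm_bound[OF Uc] by auto
  obtain M2 where M2: "0 < M2" "\<And>x. x \<in> {0..l} \<Longrightarrow> norm (Ux t0 x) \<le> M2"
    using continuous_norm_bound[OF Uxc] by auto
  define L where "L = max L1 L2"
  define N where "N = max M1 M2"
  have L: "0 < L" "\<And>x. x \<in> {0..l} \<Longrightarrow> norm (P x) \<le> L" "\<And>x. x \<in> {0..l} \<Longrightarrow> norm (Q x) \<le> L"
    using L1 L2 by (auto simp: L_def le_max_iff_disj)
  have N: "0 < N" "\<And>x. x \<in> {0..l} \<Longrightarrow> norm (U t0 x) \<le> N" "\<And>x. x \<in> {0..l} \<Longrightarrow> norm (Ux t0 x) \<le> N"
    using M1 M2 by (auto simp: N_def le_max_iff_disj)
  obtain K where K: "0 < K" "\<And>(X :: complex^'a^'a) (Y :: complex^'a^'a). norm (X ** Y) \<le> norm X * norm Y * K"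
    using M.pos_bounded by blast
  obtain \<mu> where \<mu>: "0 < \<mu>" "\<And>x (X :: complex^'a^'a). x \<in> {0..l} \<Longrightarrow> \<mu> * norm X \<le> norm (X ** U t0 x)"
    using norm_matrix_mult_lower_bound[OF Uc det] by blast
  \<comment> \<open>\<open>B\<close> is the Lipschitz constant of the kernel equation.
    \<open>D\<close>, multiplied by the maximum of \<open>norm (g x)\<close>, will bound the
    integrand in the final Volterra equation.\<close>
  define B where "B = 2 * K * L"
  define D where "D = K * N * (2 * B + 2)"
  \<comment> \<open>The first two entries keep the kernel's arguments inside \<open>{0..l}\<close>,
    the next two give \<open>B * d\<^sup>2 \<le> 1 / 2\<close>, and the last makes the Volterra
    integral at most half of the invertible term.\<close>
  define d where "d = Min {c, (l - c) / 2, 1, 1 / (2 * B + 2), \<mu> / (2 * D)}"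
  have B0: "0 < B" using K L by (simp add: B_def)
  then have D0: "0 < D" using K N by (simp add: D_def)
  have d: "0 < d" "d \<le> c" "d \<le> (l - c) / 2" "d \<le> 1" "d \<le> 1 / (2 * B + 2)" "d \<le> \<mu> / (2 * D)"
  proof -
    show "0 < d" using c B0 D0 \<mu>(1) by (simp add: d_def)
    show "d \<le> c" "d \<le> (l - c) / 2" "d \<le> 1" "d \<le> 1 / (2 * B + 2)" "d \<le> \<mu> / (2 * D)"
      unfolding d_def by (rule Min_le; simp)+
  qed
  have dB: "B * d\<^sup>2 \<le> 1 / 2"
  proof -
    have "d\<^sup>2 \<le> d" using d by (simp add: power2_eq_square mult_left_le)
    then have "B * d\<^sup>2 \<le> B * (1 / (2 * B + 2))" using B0 d by (intro mult_left_mono) auto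
    also have "\<dots> \<le> 1 / 2" using B0 by (simp add: field_simps)
    finally show ?thesis .
  qed
  have cd: "0 \<le> c - d" "c + 2 * d \<le> l" "c + d \<le> l" using d by (auto simp: field_simps)
  define g where "g x = integral {c..x} (\<lambda>y. Q y - P y)" for x
  obtain F k where kern: "goursat_kernel ((**) :: complex^'a^'a \<Rightarrow> complex^'a^'a \<Rightarrow> complex^'a^'a) c d g (\<lambda>x. Q x - P x) F k"
    and F_eq: "\<And>s r. s \<in> {c..c+d} \<Longrightarrow> r \<in> {0..d} \<Longrightarrow> F (s, r) = Q (s + r) ** k (s, r) - k (s, r) ** P (s - r)"
    and F_le: "\<And>z. z \<in> {c..c+d} \<times> {0..d} \<Longrightarrow> norm (F z) \<le> B * norm (k z)"
    using goursat_kernel_exists[OF P Q cd(1,2) d(1) L(2,3) K B_def dB] unfolding g_def[abs_def] by blast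
  interpret goursat_kernel "(**) :: complex^'a^'a \<Rightarrow> complex^'a^'a \<Rightarrow> complex^'a^'a" c d g "\<lambda>x. Q x - P x" F k by (rule kern)
  have sub: "{c-d..c+d} \<subseteq> {0..l}" "{c..c+d} \<subseteq> {c-d..c+d}" "{c..c+d} \<subseteq> {0..l}" using cd d(1) c by auto
  define v where "v t x = integral {c..x} (\<lambda>s. k (s, x - s) ** U t (2 * s - x))" for t x
  define vt where "vt t x = integral {c..x} (\<lambda>s. k (s, x - s) ** Ut t (2 * s - x))" for t x
  define vx where "vx t x = g x ** U t x +
      integral {c..x} (\<lambda>s. p (s, x - s) ** U t (2 * s - x) - k (s, x - s) ** Ux t (2 * s - x))" for t x
  have Uc': "continuous_on ({0..T} \<times> {c-d..c+d}) (\<lambda>(t, x). U t x)"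
    and Utc': "continuous_on ({0..T} \<times> {c-d..c+d}) (\<lambda>(t, x). Ut t x)"
    using U' sub by (auto intro: continuous_on_subset[of "{0..T} \<times> {0..l}"])
  have UD: "(U t has_vector_derivative Ux t y) (at y within {c-d..c+d})"
    "(Ux t has_vector_derivative P y ** U t y + mat \<sigma> ** Ut t y) (at y within {c-d..c+d})"
    if "t \<in> {0..T}" "y \<in> {c-d..c+d}" for t y
    using that sub by (auto intro!: has_vector_derivative_within_subset[OF UxD sub(1)]
        has_vector_derivative_within_subset[OF UxxD sub(1)])
  have Uyc: "continuous_on {c-d..c+d} (U t)" "continuous_on {c-d..c+d} (Ux t)"
    "continuous_on {c-d..c+d} (Ut t)"
    "continuous_on {c-d..c+d} (\<lambda>y. P y ** U t y)"
    "continuous_on {c-d..c+d} (\<lambda>y. P y ** U t y + mat \<sigma> ** Ut t y)" if "t \<in> {0..T}" for t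
  proof -
    show 1: "continuous_on {c-d..c+d} (U t)" "continuous_on {c-d..c+d} (Ux t)"
      by (rule continuous_on_vector_derivative[OF UD(1)[OF that]]
          continuous_on_vector_derivative[OF UD(2)[OF that]]; assumption)+
    show 2: "continuous_on {c-d..c+d} (Ut t)"
      using continuous_on_slice(2)[OF Utc' that] by simp
    show "continuous_on {c-d..c+d} (\<lambda>y. P y ** U t y)"
      "continuous_on {c-d..c+d} (\<lambda>y. P y ** U t y + mat \<sigma> ** Ut t y)"
      by (intro continuous_intros M.continuous_on continuous_on_subset[OF P sub(1)] 1 2)+
  qed
  have vxD: "(v t has_vector_derivative vx t x) (at x within {c..c+d})"
    if "t \<in> {0..T}" "x \<in> {c..c+d}" for t x
    unfolding v_def[abs_def] vx_def
    by (rule integral_k_deriv[OF UD(1)[OF that(1)] Uyc(2)[OF that(1)] that(2)])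
  have vxxD: "(vx t has_vector_derivative (Q x - P x) ** U t x + Q x ** v t x + mat \<sigma> ** vt t x) (at x within {c..c+d})"
    if t: "t \<in> {0..T}" and x: "x \<in> {c..c+d}" for t x
  proof -
    note int = integrable_continuous_real[OF triangle_slice]
    \<comment> \<open>The term \<open>k ** P\<close> in \<open>F\<close> cancels the potential term
      of the equation for \<open>U\<close>, so that \<open>Q x\<close> and
      \<open>mat \<sigma>\<close> can be taken out of the integral.\<close>
    have "integral {c..x} (\<lambda>s. F (s, x - s) ** U t (2 * s - x) +
          k (s, x - s) ** (P (2 * s - x) ** U t (2 * s - x) + mat \<sigma> ** Ut t (2 * s - x))) =
        integral {c..x} (\<lambda>s. Q x ** (k (s, x - s) ** U t (2 * s - x)) + mat \<sigma> ** (k (s, x - s) ** Ut t (2 * s - x)))"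
    proof (rule integral_cong)
      fix s assume "s \<in> {c..x}"
      then have F: "F (s, x - s) = Q x ** k (s, x - s) - k (s, x - s) ** P (2 * s - x)"
        using F_eq[of s "x - s"] x by (simp add: algebra_simps)
      show "F (s, x - s) ** U t (2 * s - x) +
          k (s, x - s) ** (P (2 * s - x) ** U t (2 * s - x) + mat \<sigma> ** Ut t (2 * s - x)) =
        Q x ** (k (s, x - s) ** U t (2 * s - x)) + mat \<sigma> ** (k (s, x - s) ** Ut t (2 * s - x))"
        unfolding F by (simp add: M.diff_left M.add_right matrix_mul_assoc mat_commute[of \<sigma> "k (s, x - s)"])
    qed
    also have "\<dots> = Q x ** v t x + mat \<sigma> ** vt t x"
      unfolding v_def vt_def
      by (intro integral_unique has_integral_add has_integral_linear[OF _ M.bounded_linear_right, unfolded o_def]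
          integrable_integral int k_cont Uyc t x)
    finally show ?thesis
      using integral_k_deriv2[OF UD(1)[OF t] UD(2)[OF t] Uyc(5)[OF t] x]
      by (simp add: vx_def[abs_def] add.assoc)
  qed
  have w: "V t x - U t x - v t x = 0" if t: "t \<in> {0..T}" and x: "x \<in> {c..c+d}" for t x
  proof (rule sideways_uniqueness[OF M.bounded_bilinear_axioms, where a = c and b = "c + d" and Q = Q and m = "mat \<sigma>"
        and \<alpha> = 0 and \<beta> = T and z = "\<lambda>t x. V t x - U t x - v t x"
        and zt = "\<lambda>t x. Vt t x - Ut t x - vt t x" and zx = "\<lambda>t x. Vx t x - Ux t x - vx t x"])
    have sub2: "{0..T} \<times> {c..c+d} \<subseteq> {0..T} \<times> {0..l}" using sub by auto
    have vc: "continuous_on ({0..T} \<times> {c..c+d}) (\<lambda>z. v (fst z) (snd z))"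
      "continuous_on ({0..T} \<times> {c..c+d}) (\<lambda>z. vt (fst z) (snd z))"
      using kernel_transform_time_dependent[OF Uc'] kernel_transform_time_dependent[OF Utc']
      by (auto simp: v_def vt_def case_prod_unfold)
    show "continuous_on ({0..T} \<times> {c..c+d}) (\<lambda>(t, x). V t x - U t x - v t x)"
      "continuous_on ({0..T} \<times> {c..c+d}) (\<lambda>(t, x). Vt t x - Ut t x - vt t x)"
      using U' V' vc unfolding case_prod_unfold
      by (auto intro!: continuous_on_diff intro: continuous_on_subset[OF _ sub2])
    fix t assume t: "t \<in> {0..T}"
    have z0: "V t x - U t x = 0" if "x \<in> {0..c}" for x
      using agree[OF _ _ _ t that] by simp
    show "V t c - U t c - v t c = 0"
      using z0[of c] c by (simp add: v_def)
    \<comment> \<open>\<open>V - U\<close> vanishes to the left of \<open>c\<close>, and its left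
      derivative determines the derivative at \<open>c\<close>. Both terms of \<open>vx\<close>
      vanish at \<open>c\<close> because they contain integrals over a point.\<close>
    have "Vx t c - Ux t c = 0"
      by (rule vector_derivative_zero_on[OF has_vector_derivative_diff[OF VxD[OF t] UxD[OF t]], where c = 0 and d = c])
        (use z0 c in auto)
    then show "Vx t c - Ux t c - vx t c = 0"
      by (simp add: vx_def g_def)
    fix x assume x: "x \<in> {c..c+d}"
    then have xl: "x \<in> {0..l}" using sub by auto
    show "((\<lambda>t. V t x - U t x - v t x) has_vector_derivative Vt t x - Ut t x - vt t x) (at t within {0..T})"
      unfolding v_def vt_def
      by (intro has_vector_derivative_diff VtD UtD t xl kernel_transform_time_deriv[OF Uc' Utc' _ _ _ x])
        (use UtD sub in auto)
    show "((\<lambda>x. V t x - U t x - v t x) has_vector_derivative Vx t x - Ux t x - vx t x) (at x within {c..c+d})"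
      by (intro has_vector_derivative_diff vxD t x has_vector_derivative_within_subset[OF VxD sub(3)]
          has_vector_derivative_within_subset[OF UxD sub(3)] xl)
    have "((\<lambda>x. Vx t x - Ux t x - vx t x) has_vector_derivative
        (Q x ** V t x + mat \<sigma> ** Vt t x) - (P x ** U t x + mat \<sigma> ** Ut t x) -
        ((Q x - P x) ** U t x + Q x ** v t x + mat \<sigma> ** vt t x)) (at x within {c..c+d})"
      by (intro has_vector_derivative_diff vxxD t x has_vector_derivative_within_subset[OF VxxD sub(3)]
          has_vector_derivative_within_subset[OF UxxD sub(3)] xl)
    then show "((\<lambda>x. Vx t x - Ux t x - vx t x) has_vector_derivative
        Q x ** (V t x - U t x - v t x) + mat \<sigma> ** (Vt t x - Ut t x - vt t x)) (at x within {c..c+d})"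
      by (simp add: M.diff_right M.add_right M.diff_left algebra_simps)
  qed (use T t x continuous_on_subset[OF Q sub(3)] in auto)
  \<comment> \<open>At time \<open>t0\<close> the difference \<open>V - U\<close> vanishes, hence so
    does \<open>v\<close>, and with it the derivative in \<open>x\<close>.\<close>
  have vx0: "vx t0 x = 0" if "x \<in> {c..c+d}" for x
    by (rule vector_derivative_zero_on[OF vxD[OF t0 that], where c = c and d = "c + d"])
      (use w[OF t0] init sub that d(1) in auto)
  let ?R = "{c..c+d} \<times> {0..d}"
  have "compact ?R" "?R \<noteq> {}" using d by (auto intro: compact_Times)
  from continuous_attains_sup[OF this continuous_on_norm[OF k_cont]]
  obtain z where z: "z \<in> ?R" "\<And>z'. z' \<in> ?R \<Longrightarrow> norm (k z') \<le> norm (k z)"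
    by blast
  have gc: "continuous_on {c..c+d} g"
    using g by (rule continuous_on_vector_derivative)
  from continuous_attains_sup[OF _ _ continuous_on_norm[OF gc]] d
  obtain x where x: "x \<in> {c..c+d}" "\<And>x'. x' \<in> {c..c+d} \<Longrightarrow> norm (g x') \<le> norm (g x)"
    by auto
  define G where "G = norm (g x)"
  have G0: "0 \<le> G" by (simp add: G_def)
  \<comment> \<open>At a maximum point of \<open>norm k\<close> the double integral is at most half
    of that maximum, so \<open>k\<close> is controlled by its diagonal data
    \<open>g\<close>.\<close>
  have kz: "norm (k z) \<le> 2 * G"
  proof -
    obtain s r where sr: "z = (s, r)" "s \<in> {c..c+d}" "r \<in> {0..d}" using z(1) by auto
    have "norm (integral {c..s} (\<lambda>\<sigma>. integral {0..r} (\<lambda>\<rho>. F (\<sigma>, \<rho>)))) \<le> B * norm (k z) * (r - 0) * (s - c)"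
      by (rule norm_double_integral_le[OF F])
        (use sr z(2) F_le B0 in \<open>auto intro!: order_trans[OF F_le] mult_left_mono\<close>)
    also have "\<dots> \<le> B * norm (k z) * d * d"
      using sr B0 d by (intro mult_mono) auto
    also have "\<dots> = (B * d\<^sup>2) * norm (k z)" by (simp add: power2_eq_square)
    also have "\<dots> \<le> 1 / 2 * norm (k z)" using dB by (rule mult_right_mono) simp
    finally have "norm (k z) \<le> norm (g s) + 1 / 2 * norm (k z)"
      using k[OF sr(2,3)] sr(1) norm_triangle_ineq[of "g s"] by (smt (verit))
    then show ?thesis using x(2)[OF sr(2)] by (simp add: G_def)
  qed
  have k_le: "norm (k z') \<le> 2 * G" if "z' \<in> ?R" for z'
    using z(2)[OF that] kz by simp
  have p_le: "norm (p z') \<le> 2 * B * G" if z': "z' \<in> ?R" for z'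
  proof -
    have "norm (p z') \<le> (B * (2 * G)) * (fst z' - c)"
      unfolding p_def
    proof (rule integral_bound)
      show "continuous_on {c..fst z'} (\<lambda>\<sigma>. F (\<sigma>, snd z'))"
        using continuous_on_subset[OF continuous_on_slice(1)[OF F, of "snd z'"]] z' by auto
      show "norm (F (s, snd z')) \<le> B * (2 * G)" if "s \<in> {c..fst z'}" for s
        using that z' B0 by (intro order_trans[OF F_le] mult_left_mono k_le) auto
    qed (use z' in auto)
    also have "\<dots> \<le> (B * (2 * G)) * 1"
      using z' B0 G0 d by (intro mult_left_mono) auto
    finally show ?thesis by simp
  qed
  have "G = 0"
  proof -
    have xl: "x \<in> {0..l}" using x sub by auto
    let ?I = "integral {c..x} (\<lambda>s. p (s, x - s) ** U t0 (2 * s - x) - k (s, x - s) ** Ux t0 (2 * s - x))"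
    have "norm ?I \<le> (D * G) * (x - c)"
    proof (rule integral_bound)
      show "continuous_on {c..x} (\<lambda>s. p (s, x - s) ** U t0 (2 * s - x) - k (s, x - s) ** Ux t0 (2 * s - x))"
        by (intro continuous_intros triangle_slice p_cont k_cont Uyc t0 x)
      fix s assume s: "s \<in> {c..x}"
      then have R: "(s, x - s) \<in> ?R" and l: "2 * s - x \<in> {0..l}" using x sub cd by auto
      have "norm (p (s, x - s) ** U t0 (2 * s - x)) \<le> (2 * B * G) * N * K"
        using K(1) B0 G0 by (intro order_trans[OF K(2)] mult_right_mono mult_mono p_le N R l) auto
      moreover have "norm (k (s, x - s) ** Ux t0 (2 * s - x)) \<le> (2 * G) * N * K"
        using K(1) G0 by (intro order_trans[OF K(2)] mult_right_mono mult_mono k_le N R l) auto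
      ultimately show "norm (p (s, x - s) ** U t0 (2 * s - x) - k (s, x - s) ** Ux t0 (2 * s - x)) \<le> D * G"
        by (intro order_trans[OF norm_triangle_ineq4]) (simp add: D_def algebra_simps)
    qed (use x in auto)
    also have "\<dots> \<le> (D * G) * (\<mu> / (2 * D))"
      using x D0 G0 d by (intro mult_left_mono) auto
    also have "\<dots> = \<mu> * G / 2" using D0 by simp
    finally have "norm ?I \<le> \<mu> * G / 2" .
    \<comment> \<open>This is the Volterra equation at a maximum point of \<open>norm g\<close>: its
      left side has norm at least \<open>\<mu> * G\<close>, its right side at most half of
      that.\<close>
    moreover have "g x ** U t0 x = - ?I"
      using vx0[OF x(1)] by (simp add: vx_def eq_neg_iff_add_eq_0)
    ultimately have "\<mu> * G \<le> \<mu> * G / 2"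
      using \<mu>(2)[OF xl, of "g x"] by (simp add: G_def)
    then have "\<mu> * G \<le> 0" by linarith
    then show ?thesis using \<mu>(1) G0 by (simp add: mult_le_0_iff)
  qed
  then have g0: "g x' = 0" if "x' \<in> {c..c+d}" for x'
    using x(2)[OF that] by (simp add: G_def)
  have "Q x - P x = 0" if "x \<in> {c..c+d}" for x
    by (rule vector_derivative_zero_on[OF g[OF that], where c = c and d = "c + d"]) (use g0 that d(1) in auto)
  then show ?thesis using d(1) cd(3) by (intro exI[of _ d]) auto
qed

subsection \<open>Reduction to matrix-valued solutions\<close>

text \<open>A vector is the finite sum of its components placed on the axes, and each
  \<open>axis i\<close> is bounded linear.\<close>

lemma has_vector_derivative_vec:
  fixes f :: "real \<Rightarrow> 'a::euclidean_space^'n"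
  assumes "\<And>i. ((\<lambda>x. f x $ i) has_vector_derivative D $ i) (at x within S)"
  shows "(f has_vector_derivative D) (at x within S)"
proof -
  have axis: "bounded_linear (axis i :: 'a \<Rightarrow> 'a^'n)" for i
    unfolding linear_conv_bounded_linear[symmetric]
    by (auto intro!: linearI simp: axis_def vec_eq_iff)
  have sum: "(\<Sum>i\<in>UNIV. axis i (v $ i)) = v" for v :: "'a^'n"
    by (simp add: vec_eq_iff axis_def if_distrib cong: if_cong)
  have "((\<lambda>x. \<Sum>i\<in>UNIV. axis i (f x $ i)) has_vector_derivative (\<Sum>i\<in>UNIV. axis i (D $ i))) (at x within S)"
    by (intro has_vector_derivative_sum bounded_linear.has_vector_derivative[OF axis] assms)
  then show ?thesis by (simp add: sum)
qed

lemma has_vector_derivative_matrix_of_columns: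
  assumes "\<And>k. (f k has_vector_derivative D k) (at x within S)"
  shows "((\<lambda>x. matrix_of_columns (\<lambda>k. f k x)) has_vector_derivative matrix_of_columns D) (at x within S)"
  by (intro has_vector_derivative_vec)
    (simp add: matrix_of_columns_def bounded_linear.has_vector_derivative[OF bounded_linear_vec_nth assms])

lemma continuous_on_matrix_of_columns:
  assumes "\<And>k. continuous_on S (f k)"
  shows "continuous_on S (\<lambda>x. matrix_of_columns (\<lambda>k. f k x))"
  unfolding matrix_of_columns_def by (intro continuous_intros assms)

text \<open>This carries hypotheses stated on open intervals to the end points.\<close>

lemma continuous_eq_on_closed_interval:
  fixes f g :: "real \<Rightarrow> 'a::real_normed_vector"
  assumes "continuous_on {a..b} f" "continuous_on {a..b} g"
    and "\<And>x. x \<in> {a<..<b} \<Longrightarrow> f x = g x" and "a < b" "x \<in> {a..b}"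
  shows "f x = g x"
proof -
  have cl: "closure {a<..<b} = {a..b}" using \<open>a < b\<close> by simp
  have "f x - g x = 0"
    by (rule continuous_constant_on_closure[of "{a<..<b}" "\<lambda>x. f x - g x"])
      (use assms in \<open>auto simp: cl intro: continuous_on_diff\<close>)
  then show ?thesis by simp
qed

lemma vector_derivative_within_Icc:
  assumes "(f has_vector_derivative D) (at x within {a..b})" "a < b" "x \<in> {a..b}"
  shows "vector_derivative f (at x within {a..b}) = D"
  using vector_derivative_within_cbox[of a b x f D] assms by simp

text \<open>Regularity is given for components, while the partial derivatives are taken of whole
  vectors. Uniqueness of derivatives on a nondegenerate interval identifies the two; for the second
  derivative the first ones must be identified on all of \<open>{0..l}\<close> beforehand.\<close>

lemma C12_vectorD:
  fixes u :: "real \<Rightarrow> real \<Rightarrow> complex^'n"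
  assumes u: "\<And>i. (\<lambda>t x. u t x $ i) \<in> C12_functions T l" and T: "0 < T" and l: "0 < l"
  shows "\<And>t x. t \<in> {0..T} \<Longrightarrow> x \<in> {0..l} \<Longrightarrow>
           ((\<lambda>s. u s x) has_vector_derivative partial_t T u t x) (at t within {0..T})"
    and "\<And>t x. t \<in> {0..T} \<Longrightarrow> x \<in> {0..l} \<Longrightarrow>
           (u t has_vector_derivative partial_x l u t x) (at x within {0..l})"
    and "\<And>t x. t \<in> {0..T} \<Longrightarrow> x \<in> {0..l} \<Longrightarrow>
           (partial_x l u t has_vector_derivative partial_xx l u t x) (at x within {0..l})"
    and "continuous_on ({0..T} \<times> {0..l}) (\<lambda>(t, x). u t x)"
    and "continuous_on ({0..T} \<times> {0..l}) (\<lambda>(t, x). partial_t T u t x)"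
    and "continuous_on ({0..T} \<times> {0..l}) (\<lambda>(t, x). partial_x l u t x)"
    and "continuous_on ({0..T} \<times> {0..l}) (\<lambda>(t, x). partial_xx l u t x)"
proof -
  let ?u = "\<lambda>i t x. u t x $ i"
  note C = u[unfolded C12_functions_def mem_Collect_eq]
  have t1: "((\<lambda>s. u s x) has_vector_derivative (\<chi> i. partial_t T (?u i) t x)) (at t within {0..T})"
    if "t \<in> {0..T}" "x \<in> {0..l}" for t x
    using C that by (intro has_vector_derivative_vec)
      (simp add: partial_t_def vector_derivative_works[symmetric])
  have x1: "(u t has_vector_derivative (\<chi> i. partial_x l (?u i) t x)) (at x within {0..l})"
    if "t \<in> {0..T}" "x \<in> {0..l}" for t x
    using C that by (intro has_vector_derivative_vec)
      (simp add: partial_x_def vector_derivative_works[symmetric])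
  have pt: "partial_t T u t x = (\<chi> i. partial_t T (?u i) t x)" if "t \<in> {0..T}" "x \<in> {0..l}" for t x
    unfolding partial_t_def[of T u] by (rule vector_derivative_within_Icc[OF t1[OF that] T that(1)])
  have px: "partial_x l u t x = (\<chi> i. partial_x l (?u i) t x)" if "t \<in> {0..T}" "x \<in> {0..l}" for t x
    unfolding partial_x_def[of l u] by (rule vector_derivative_within_Icc[OF x1[OF that] l that(2)])
  have x2: "(partial_x l u t has_vector_derivative (\<chi> i. partial_xx l (?u i) t x)) (at x within {0..l})"
    if tx: "t \<in> {0..T}" "x \<in> {0..l}" for t x
  proof -
    have "((\<lambda>x. \<chi> i. partial_x l (?u i) t x) has_vector_derivative (\<chi> i. partial_xx l (?u i) t x)) (at x within {0..l})"
    proof (rule has_vector_derivative_vec)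
      fix i
      have "((\<lambda>y. partial_x l (?u i) t y) has_vector_derivative partial_xx l (?u i) t x) (at x within {0..l})"
        unfolding partial_xx_def partial_x_def[of l "partial_x l (?u i)"]
        using C tx by (simp add: vector_derivative_works[symmetric])
      then show "((\<lambda>x. (\<chi> i. partial_x l (?u i) t x) $ i) has_vector_derivative (\<chi> i. partial_xx l (?u i) t x) $ i)
          (at x within {0..l})" by simp
    qed
    from has_vector_derivative_transform[OF tx(2) px[OF tx(1)] this] show ?thesis .
  qed
  have pxx: "partial_xx l u t x = (\<chi> i. partial_xx l (?u i) t x)" if "t \<in> {0..T}" "x \<in> {0..l}" for t x
    unfolding partial_xx_def[of l u] partial_x_def[of l "partial_x l u"]
    by (rule vector_derivative_within_Icc[OF x2[OF that] l that(2)])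
  show "\<And>t x. t \<in> {0..T} \<Longrightarrow> x \<in> {0..l} \<Longrightarrow>
           ((\<lambda>s. u s x) has_vector_derivative partial_t T u t x) (at t within {0..T})"
    and "\<And>t x. t \<in> {0..T} \<Longrightarrow> x \<in> {0..l} \<Longrightarrow>
           (u t has_vector_derivative partial_x l u t x) (at x within {0..l})"
    and "\<And>t x. t \<in> {0..T} \<Longrightarrow> x \<in> {0..l} \<Longrightarrow>
           (partial_x l u t has_vector_derivative partial_xx l u t x) (at x within {0..l})"
    using t1 x1 x2 by (simp_all only: pt px pxx)
  have cont: "continuous_on ({0..T} \<times> {0..l}) (\<lambda>(t, x). f t x)"
    if "\<And>i. continuous_on ({0..T} \<times> {0..l}) (\<lambda>(t, x). f' i t x)"
      "\<And>t x. t \<in> {0..T} \<Longrightarrow> x \<in> {0..l} \<Longrightarrow> f t x = (\<chi> i. f' i t x)"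
    for f :: "real \<Rightarrow> real \<Rightarrow> complex^'n" and f'
  proof -
    have "continuous_on ({0..T} \<times> {0..l}) (\<lambda>z. \<chi> i. f' i (fst z) (snd z))"
      using that(1) by (intro continuous_intros) (simp add: case_prod_unfold)
    then show ?thesis
      by (rule continuous_on_eq) (auto simp: that(2))
  qed
  show "continuous_on ({0..T} \<times> {0..l}) (\<lambda>(t, x). u t x)"
    by (rule cont[of ?u]) (use C in auto)
  show "continuous_on ({0..T} \<times> {0..l}) (\<lambda>(t, x). partial_t T u t x)"
    by (rule cont[OF _ pt]) (use C in auto)
  show "continuous_on ({0..T} \<times> {0..l}) (\<lambda>(t, x). partial_x l u t x)"
    by (rule cont[OF _ px]) (use C in auto)
  show "continuous_on ({0..T} \<times> {0..l}) (\<lambda>(t, x). partial_xx l u t x)"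
    by (rule cont[OF _ pxx]) (use C in auto)
qed

lemma C1_matrix_continuous:
  assumes "\<And>i j. (\<lambda>x. P x $ i $ j) \<in> C1_functions l"
  shows "continuous_on {0..l} (P :: real \<Rightarrow> complex^'n^'m)"
proof -
  have h: "continuous_on {0..l} (\<lambda>x. P x $ i $ j)" for i j
    using assms[of i j] by (auto simp: C1_functions_def intro!: differentiable_imp_continuous_on
        simp: differentiable_on_def)
  have "continuous_on {0..l} (\<lambda>x. \<chi> i j. P x $ i $ j)"
    by (intro continuous_on_vec_lambda h)
  moreover have "(\<lambda>x. \<chi> i j. P x $ i $ j) = P" by (simp add: fun_eq_iff vec_eq_iff)
  ultimately show ?thesis by metis
qed

text \<open>The vector equations hold column by column in the open rectangle. All terms are
  continuous, so the matrix equation persists on the closure, where one-sided derivatives are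
  used.\<close>

lemma matrix_solution_of_columns:
  fixes u :: "'n \<Rightarrow> real \<Rightarrow> real \<Rightarrow> complex^'n"
  assumes l: "0 < l" and T: "0 < T"
    and P: "continuous_on {0..l} P"
    and u: "\<And>k i. (\<lambda>t x. u k t x $ i) \<in> C12_functions T l"
    and pde: "\<And>k t x. 0 < x \<Longrightarrow> x < l \<Longrightarrow> 0 < t \<Longrightarrow> t < T \<Longrightarrow>
           \<sigma> *s partial_t T (u k) t x = partial_xx l (u k) t x - P x *v u k t x"
  shows "matrix_solution T l \<sigma> P (\<lambda>t x. matrix_of_columns (\<lambda>k. u k t x))
    (\<lambda>t x. matrix_of_columns (\<lambda>k. partial_t T (u k) t x))
    (\<lambda>t x. matrix_of_columns (\<lambda>k. partial_x l (u k) t x))"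
proof -
  interpret bounded_bilinear "(**) :: complex^'n^'n \<Rightarrow> complex^'n^'n \<Rightarrow> complex^'n^'n"
    by (rule bounded_bilinear_matrix_mult)
  note C = C12_vectorD[OF u T l]
  let ?c = "matrix_of_columns :: ('n \<Rightarrow> complex^'n) \<Rightarrow> _"
  let ?U = "\<lambda>z. ?c (\<lambda>k. u k (fst z) (snd z))" and ?Ut = "\<lambda>z. ?c (\<lambda>k. partial_t T (u k) (fst z) (snd z))"
  let ?Uxx = "\<lambda>z. ?c (\<lambda>k. partial_xx l (u k) (fst z) (snd z))"
  let ?R = "{0..T} \<times> {0..l}"
  have cont: "continuous_on ?R ?U" "continuous_on ?R ?Ut" "continuous_on ?R ?Uxx"
    using C(4,5,7) by (auto intro!: continuous_on_matrix_of_columns simp: case_prod_unfold)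
  have cl: "closure ({0<..<T} \<times> {0<..<l}) = ?R"
    using T l by (simp add: closure_Times)
  have eq: "?Uxx z - (P (snd z) ** ?U z + mat \<sigma> ** ?Ut z) = 0" if "z \<in> ?R" for z
  proof (rule continuous_constant_on_closure[of "{0<..<T} \<times> {0<..<l}"
        "\<lambda>z. ?Uxx z - (P (snd z) ** ?U z + mat \<sigma> ** ?Ut z)"])
    show "continuous_on (closure ({0<..<T} \<times> {0<..<l})) (\<lambda>z. ?Uxx z - (P (snd z) ** ?U z + mat \<sigma> ** ?Ut z))"
      unfolding cl by (intro continuous_intros continuous_on cont continuous_on_compose2[OF P]) auto
    show "?Uxx z - (P (snd z) ** ?U z + mat \<sigma> ** ?Ut z) = 0" if "z \<in> {0<..<T} \<times> {0<..<l}" for z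
    proof -
      have "\<sigma> *s partial_t T (u k) (fst z) (snd z) =
          partial_xx l (u k) (fst z) (snd z) - P (snd z) *v u k (fst z) (snd z)" for k
        using that by (intro pde) auto
      then have "\<sigma> * partial_t T (u k) (fst z) (snd z) $ i =
          partial_xx l (u k) (fst z) (snd z) $ i - (P (snd z) *v u k (fst z) (snd z)) $ i" for k i
        by (metis vector_minus_component vector_smult_component)
      then show ?thesis
        by (simp add: vec_eq_iff matrix_of_columns_def matrix_matrix_mult_def matrix_vector_mult_def
            mat_def if_distrib if_distribR cong: if_cong)
    qed
  qed (use that cl in auto)
  then have eq': "?c (\<lambda>k. partial_xx l (u k) t x) = P x ** ?c (\<lambda>k. u k t x) + mat \<sigma> ** ?c (\<lambda>k. partial_t T (u k) t x)"
    if "t \<in> {0..T}" "x \<in> {0..l}" for t x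
    using that eq[of "(t, x)"] by simp
  show ?thesis
    unfolding matrix_solution_def case_prod_unfold
  proof (intro conjI ballI cont)
    fix t x assume tx: "t \<in> {0..T}" "x \<in> {0..l}"
    show "((\<lambda>t. ?c (\<lambda>k. u k t x)) has_vector_derivative ?c (\<lambda>k. partial_t T (u k) t x)) (at t within {0..T})"
      "((\<lambda>x. ?c (\<lambda>k. u k t x)) has_vector_derivative ?c (\<lambda>k. partial_x l (u k) t x)) (at x within {0..l})"
      "((\<lambda>x. ?c (\<lambda>k. partial_x l (u k) t x)) has_vector_derivative
        P x ** ?c (\<lambda>k. u k t x) + mat \<sigma> ** ?c (\<lambda>k. partial_t T (u k) t x)) (at x within {0..l})"
      unfolding eq'[OF tx, symmetric]
      by (intro has_vector_derivative_matrix_of_columns C tx)+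
  qed
qed

section \<open>Continuation of the agreement from a neighbourhood of 0 to the whole interval\<close>

theorem theorem6:
  fixes l T :: real
    and P Q :: "real \<Rightarrow> complex ^ 'n ^ 'n"
    and \<sigma> :: complex
    and u u' :: "'n \<Rightarrow> real \<Rightarrow> real \<Rightarrow> complex ^ 'n"
  assumes "l > 0" and "T > 0" and "\<sigma> \<noteq> 0"
    and "\<And>i j. (\<lambda>x. P x $ i $ j) \<in> C1_functions l"
    and "\<And>i j. (\<lambda>x. Q x $ i $ j) \<in> C1_functions l"
    and "\<And>k i. (\<lambda>t x. u k t x $ i) \<in> C12_functions T l"
    and "\<And>k i. (\<lambda>t x. u' k t x $ i) \<in> C12_functions T l"
    and "\<And>k t x. 0 < x \<Longrightarrow> x < l \<Longrightarrow> 0 < t \<Longrightarrow> t < T \<Longrightarrow>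
           \<sigma> *s partial_t T (u k) t x = partial_xx l (u k) t x - P x *v u k t x"
    and "\<And>k t x. 0 < x \<Longrightarrow> x < l \<Longrightarrow> 0 < t \<Longrightarrow> t < T \<Longrightarrow>
           \<sigma> *s partial_t T (u' k) t x = partial_xx l (u' k) t x - Q x *v u' k t x"
    and "((\<forall>x\<in>{0<..<l}. \<forall>k. u k 0 x = u' k 0 x) \<and>
          (\<forall>x\<in>{0..l}. cmod (det (matrix_of_columns (\<lambda>k. u k 0 x))) > 0)) \<or>
         ((\<forall>x\<in>{0<..<l}. \<forall>k. u k T x = u' k T x) \<and>
          (\<forall>x\<in>{0..l}. cmod (det (matrix_of_columns (\<lambda>k. u k T x))) > 0))"
    and "\<exists>\<epsilon>\<in>{0<..<l}. \<forall>x\<in>{0<..<\<epsilon>}. P x = Q x"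
    and "\<And>t k. t \<in> {0<..<T} \<Longrightarrow> u k t 0 = u' k t 0"
    and "\<And>t k. t \<in> {0<..<T} \<Longrightarrow> partial_x l (u k) t 0 = partial_x l (u' k) t 0"
  shows "\<forall>x\<in>{0..l}. P x = Q x"
proof -
  note l = assms(1) and T = assms(2)
  note P = C1_matrix_continuous[OF assms(4)] and Q = C1_matrix_continuous[OF assms(5)]
  note U = matrix_solution_of_columns[OF l T P assms(6,8)]
    and V = matrix_solution_of_columns[OF l T Q assms(7,9)]
  note Cu = C12_vectorD[OF assms(6) T l] and Cu' = C12_vectorD[OF assms(7) T l]
  have 0: "0 \<in> {0..l}" using l by simp
  have bc: "u k t 0 = u' k t 0" "partial_x l (u k) t 0 = partial_x l (u' k) t 0"
    if "t \<in> {0..T}" for k t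
  proof -
    show "u k t 0 = u' k t 0"
      by (rule continuous_eq_on_closed_interval[where f = "\<lambda>t. u k t 0", OF _ _ assms(12) T that])
        (use continuous_on_slice(1)[OF Cu(4) 0] continuous_on_slice(1)[OF Cu'(4) 0] in auto)
    show "partial_x l (u k) t 0 = partial_x l (u' k) t 0"
      by (rule continuous_eq_on_closed_interval[where f = "\<lambda>t. partial_x l (u k) t 0", OF _ _ assms(13) T that])
        (use continuous_on_slice(1)[OF Cu(6) 0] continuous_on_slice(1)[OF Cu'(6) 0] in auto)
  qed
  \<comment> \<open>The two alternatives differ only in the time at which the solutions agree;
    \<open>t0\<close> is 0 or \<open>T\<close>.\<close>
  obtain t0 where t0: "t0 \<in> {0..T}" and init: "\<And>k x. x \<in> {0<..<l} \<Longrightarrow> u k t0 x = u' k t0 x"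
    and det: "\<And>x. x \<in> {0..l} \<Longrightarrow> det (matrix_of_columns (\<lambda>k. u k t0 x)) \<noteq> 0"
    using assms(10) T that[of 0] that[of T] by fastforce
  have init': "u k t0 x = u' k t0 x" if "x \<in> {0..l}" for k x
    by (rule continuous_eq_on_closed_interval[where f = "u k t0", OF _ _ init l that])
      (use continuous_on_slice(2)[OF Cu(4) t0] continuous_on_slice(2)[OF Cu'(4) t0] in auto)
  obtain \<epsilon> where \<epsilon>: "\<epsilon> \<in> {0<..<l}" "\<And>x. x \<in> {0<..<\<epsilon>} \<Longrightarrow> P x = Q x"
    using assms(11) by blast
  \<comment> \<open>Agreement is required on the whole initial segment, as the extension step needs
    it on all of \<open>{0..c}\<close>. The supremum inherits the property by continuity of
    \<open>P\<close> and \<open>Q\<close>.\<close>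
  define S where "S = {x \<in> {0..l}. \<forall>y\<in>{0..x}. P y = Q y}"
  have left: "P x = Q x" if "c \<in> {0..l}" "0 < c" "\<And>x. x \<in> {0<..<c} \<Longrightarrow> P x = Q x" "x \<in> {0..c}" for c x
    by (rule continuous_eq_on_closed_interval[OF _ _ that(3) that(2) that(4)])
      (use that in \<open>auto intro: continuous_on_subset[OF P] continuous_on_subset[OF Q]\<close>)
  have "\<epsilon> \<in> S"
    using left[of \<epsilon>] \<epsilon> by (auto simp: S_def)
  define c where "c = Sup S"
  have bdd: "bdd_above S" by (auto simp: S_def)
  have c: "\<epsilon> \<le> c" "c \<le> l"
    using \<open>\<epsilon> \<in> S\<close> cSup_upper[OF \<open>\<epsilon> \<in> S\<close> bdd] by (auto simp: c_def S_def intro!: cSup_least)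
  have c0: "0 < c" using c \<epsilon> by auto
  have eq: "P x = Q x" if "x \<in> {0..c}" for x
  proof (rule left[OF _ c0 _ that])
    fix x assume "x \<in> {0<..<c}"
    then obtain s where "s \<in> S" "x < s"
      using less_cSup_iff[of S x] \<open>\<epsilon> \<in> S\<close> bdd by (auto simp: c_def)
    then show "P x = Q x" using \<open>x \<in> {0<..<c}\<close> by (auto simp: S_def)
  qed (use c c0 in auto)
  have "c = l"
  proof (rule ccontr)
    assume "c \<noteq> l"
    then have "c < l" using c by simp
    \<comment> \<open>A supremum below \<open>l\<close> is positive, because it is at least
      \<open>\<epsilon>\<close>, so the extension step applies and produces a larger element of
      \<open>S\<close>.\<close>
    have "\<exists>d>0. c + d \<le> l \<and> (\<forall>x\<in>{c..c+d}. P x = Q x)"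
      by (rule potentials_agree_further[OF U V P Q eq c0 \<open>c < l\<close> T _ _ t0 _ det]) (simp_all add: bc init')
    then obtain d where d: "0 < d" "c + d \<le> l" "\<And>x. x \<in> {c..c+d} \<Longrightarrow> P x = Q x" by auto
    then have "c + d \<in> S"
      using eq c0 unfolding S_def by (auto simp: atLeastAtMost_iff) (metis linear)
    then have "c + d \<le> c" unfolding c_def by (rule cSup_upper[OF _ bdd])
    then show False using d by simp
  qed
  then show ?thesis using eq by auto
qed

end
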